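(* (Salce's Lemma) Let $\mathcal A$ be a full subcategory, closed under extensions, of an $n$-angulated category $\mathcal T$, let $\mathfrak E$ be an almost $n$-exact structure for $\mathcal A$, and let $\mathcal I$ and $\mathcal J$ be ideals in $\mathcal A$. (1) If there are enough $\mathfrak E$-injective morphisms and $\mathcal I$ is a precovering ideal, then $\mathcal I^\perp$ is a special preenveloping ideal. (2) If there are enough $\mathfrak E$-projective morphisms and $\mathcal J$ is a preenveloping ideal, then ${}^\perp\mathcal J$ is a special precovering ideal.
   Context: Let $n\geq 3$ be an integer. An $n$-angulated category is an additive category $\mathcal T$ with an automorphism $\Sigma$ and a collection of sequences $A_1\xrightarrow{\alpha_1}A_2\xrightarrow{\alpha_2}\cdots\xrightarrow{\alpha_{n-1}}A_n\xrightarrow{\alpha_n}\Sigma A_1$, called $n$-angles, satisfying the following (a morphism of such sequences is a tuple $(\varphi_1,\dots,\varphi_n)$ commuting with all maps, with $\Sigma\varphi_1$ on the last term). (F1) The collection is closed under direct sums and direct summands, contains $A\xrightarrow{1}A\to0\to\cdots\to0\to\Sigma A$ for all $A$, and every morphism $\alpha_1:A_1\to A_2$ is the first morphism of some $n$-angle. (F2) A sequence is an $n$-angle iff its left rotation $A_2\xrightarrow{\alpha_2}\cdots\xrightarrow{\alpha_n}\Sigma A_1\xrightarrow{(-1)^n\Sigma\alpha_1}\Sigma A_2$ is. (F3) Given two $n$-angles $(A_i,\alpha_i)$, $(B_i,\beta_i)$ and $\varphi_1,\varphi_2$ with $\varphi_2\alpha_1=\beta_1\varphi_1$, there are $\varphi_3,\dots,\varphi_n$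 making $(\varphi_1,\dots,\varphi_n)$ a morphism. (F4) In (F3) these can be chosen so that the cone $A_2\oplus B_1\to A_3\oplus B_2\to\cdots\to\Sigma A_1\oplus B_n\to\Sigma A_2\oplus\Sigma B_1$, with maps $\begin{pmatrix}-\alpha_{i+1}&0\\ \varphi_{i+1}&\beta_i\end{pmatrix}$ ($1\le i\le n-1$) and finally $\begin{pmatrix}-\Sigma\alpha_1&0\\ \Sigma\varphi_1&\beta_n\end{pmatrix}$, is an $n$-angle. An $n$-angle is split if $\alpha_n=0$. $\mathcal A\subseteq\mathcal T$ is a full subcategory, closed under isomorphisms and closed under extensions: for every $n$-angle with $A_1,A_n\in\mathcal A$ also $A_2,\dots,A_{n-1}\in\mathcal A$. $\mathfrak D_{\mathcal A}$ is the class of all $n$-angles with $A_1,\dots,A_n\in\mathcal A$. A class $\mathfrak E\subseteq\mathfrak D_{\mathcal A}$ is an almost $n$-exact structure for $\mathcal A$ if: (N1) $\mathfrak E$ is closed under direct sums and contains all split $n$-angles (in $\mathfrak D_{\mathcal A}$); (N2) if $\mathfrak d\in\mathfrak E$ has last morphism $\alpha_n:A_n\to\Sigma A_1$ and $f:B_n\to A_n$ is in $\mathcal A$, then every $n$-angle $A_1\to B_2\to\cdots\to B_n\xrightarrow{\alpha_nf}\Sigma A_1$ admitting a morphism of $n$-angles $(1_{A_1},*,\dots,*,f)$ to $\mathfrak d$ is in $\mathfrak E$; (N3) if $\mathfrak d\in\mathfrak E$ is as before and $g:A_1\to C_1$ is in $\mathcal A$, then every $n$-angle $C_1\to C_2\to\cdots\to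 A_n\xrightarrow{(\Sigma g)\alpha_n}\Sigma C_1$ receiving a morphism of $n$-angles $(g,*,\dots,*,1_{A_n})$ from $\mathfrak d$ is in $\mathfrak E$. For an $n$-angle in $\mathfrak E$, $\alpha_1$ is called an $\mathfrak E$-inflation, $\alpha_{n-1}$ an $\mathfrak E$-deflation and $\alpha_n$ an $\mathfrak E$-phantom; $\Phi(\mathfrak E)$ is the class of all $\mathfrak E$-phantoms. A morphism $f:X\to A$ in $\mathcal A$ is $\mathfrak E$-projective if it factors through every $\mathfrak E$-deflation $A_{n-1}\to A$; $g:A\to Y$ in $\mathcal A$ is $\mathfrak E$-injective if it factors through every $\mathfrak E$-inflation $A\to A_2$. There are enough $\mathfrak E$-injective morphisms if for every $A\in\mathcal A$ there is an $\mathfrak E$-inflation $A\to E$ which is $\mathfrak E$-injective; enough $\mathfrak E$-projective morphisms if for every $C\in\mathcal A$ there is an $\mathfrak E$-deflation $P\to C$ which is $\mathfrak E$-projective. An ideal in $\mathcal A$ is a class of morphisms of $\mathcal A$ forming a subfunctor of the (additive) bifunctor $\mathrm{Hom}_{\mathcal A}(-,-)$. An $\mathcal I$-precover of $A$ is a morphism $i:X\to A$ in $\mathcal I$ through which every morphism $X'\to A$ in $\mathcal I$ factors; $\mathcal I$-preenvelopes are dual. $\mathcal I$ is precovering (preenveloping) if every object of $\mathcal A$ has an $\mathcal I$-precover ($\mathcal I$-preenvelope). For morphisms $f:X\to A$, $g:B\to Y$ in $\mathcal A$, $f\perp g$ means $(\Sigma g)\phi f=0$ for all $\phi:A\to\Sigma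 B$ in $\Phi(\mathfrak E)$. For a class $\mathcal M$ of morphisms of $\mathcal A$, $\mathcal M^\perp=\{g: m\perp g\ \forall m\in\mathcal M\}$ and ${}^\perp\mathcal M=\{g: g\perp m\ \forall m\in\mathcal M\}$ (classes of morphisms of $\mathcal A$; they are ideals). A morphism $i:X\to A$ in an ideal $\mathcal I$ is a special $\mathcal I$-precover of $A$ if in the corresponding $n$-angle $A_1\to\cdots\to A_{n-2}\to X\xrightarrow{i}A\xrightarrow{\psi}\Sigma A_1$ one has $\psi=(\Sigma j)\phi$ with $j\in\mathcal I^\perp$, $\phi\in\Phi(\mathfrak E)$. A morphism $j:B\to Y$ in an ideal $\mathcal J$ is a special $\mathcal J$-preenvelope of $B$ if in the corresponding $n$-angle $B\xrightarrow{j}Y\to B_3\to\cdots\to B_n\xrightarrow{\psi}\Sigma B$ one has $\psi=\phi i$ with $i\in{}^\perp\mathcal J$, $\phi\in\Phi(\mathfrak E)$. An ideal is special precovering (special preenveloping) if every object of $\mathcal A$ has a special precover (special preenvelope) with respect to it. *)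

theory Defs
  imports "HOL-Algebra.Group"
begin

section \<open>Additive categories\<close>

record ('o, 'm) category =
  obj  :: "'o set"
  arr  :: "'m set"
  src  :: "'m \<Rightarrow> 'o"
  tgt  :: "'m \<Rightarrow> 'o"
  idn  :: "'o \<Rightarrow> 'm"
  comp :: "'m \<Rightarrow> 'm \<Rightarrow> 'm"  (infixl "\<cdot>\<index>" 70)

definition Hom :: "('o, 'm, 'z) category_scheme \<Rightarrow> 'o \<Rightarrow> 'o \<Rightarrow> 'm set" where
  "Hom T X Y = {f \<in> arr T. src T f = X \<and> tgt T f = Y}"

definition isomorphic :: "('o, 'm, 'z) category_scheme \<Rightarrow> 'o \<Rightarrow> 'o \<Rightarrow> bool" where
  "isomorphic T X Y \<longleftrightarrow>
     (\<exists>f \<in> Hom T X Y. \<exists>g \<in> Hom T Y X. g \<cdot>\<^bsub>T\<^esub> f = idn T X \<and> f \<cdot>\<^bsub>T\<^esub> g = idn T Y)"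

definition zero_object :: "('o, 'm, 'z) category_scheme \<Rightarrow> 'o \<Rightarrow> bool" where
  "zero_object T Z \<longleftrightarrow>
     Z \<in> obj T \<and> (\<forall>X \<in> obj T. (\<exists>!f. f \<in> Hom T X Z) \<and> (\<exists>!f. f \<in> Hom T Z X))"

locale category =
  fixes T :: "('o, 'm, 'z) category_scheme" (structure)
  assumes src_obj: "f \<in> arr T \<Longrightarrow> src T f \<in> obj T"
    and tgt_obj: "f \<in> arr T \<Longrightarrow> tgt T f \<in> obj T"
    and idn_Hom: "X \<in> obj T \<Longrightarrow> idn T X \<in> Hom T X X"
    and comp_Hom: "f \<in> Hom T X Y \<Longrightarrow> g \<in> Hom T Y Z \<Longrightarrow> g \<cdot> f \<in> Hom T X Z"
    and idn_left: "f \<in> Hom T X Y \<Longrightarrow> idn T Y \<cdot> f = f"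
    and idn_right: "f \<in> Hom T X Y \<Longrightarrow> f \<cdot> idn T X = f"
    and comp_assoc: "f \<in> Hom T W X \<Longrightarrow> g \<in> Hom T X Y \<Longrightarrow> h \<in> Hom T Y Z \<Longrightarrow>
      (h \<cdot> g) \<cdot> f = h \<cdot> (g \<cdot> f)"

record ('o, 'm) preadditive_category = "('o, 'm) category" +
  add_arr  :: "'m \<Rightarrow> 'm \<Rightarrow> 'm"
  zero_arr :: "'o \<Rightarrow> 'o \<Rightarrow> 'm"

text \<open>The additive group of morphisms, in the multiplicative notation of \<^theory>\<open>HOL-Algebra.Group\<close>.\<close>

definition hom_group :: "('o, 'm, 'z) preadditive_category_scheme \<Rightarrow> 'o \<Rightarrow> 'o \<Rightarrow> 'm monoid" where
  "hom_group T X Y = \<lparr>carrier = Hom T X Y, monoid.mult = add_arr T, one = zero_arr T X Y\<rparr>"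

definition neg_arr :: "('o, 'm, 'z) preadditive_category_scheme \<Rightarrow> 'm \<Rightarrow> 'm" where
  "neg_arr T f = inv\<^bsub>hom_group T (src T f) (tgt T f)\<^esub> f"

locale preadditive_category = category T
  for T :: "('o, 'm, 'z) preadditive_category_scheme" (structure) +
  assumes comm_group_Hom: "X \<in> obj T \<Longrightarrow> Y \<in> obj T \<Longrightarrow> comm_group (hom_group T X Y)"
    and comp_add_left: "f \<in> Hom T X Y \<Longrightarrow> g \<in> Hom T Y Z \<Longrightarrow> g' \<in> Hom T Y Z \<Longrightarrow>
      add_arr T g g' \<cdot> f = add_arr T (g \<cdot> f) (g' \<cdot> f)"
    and comp_add_right: "f \<in> Hom T X Y \<Longrightarrow> f' \<in> Hom T X Y \<Longrightarrow> g \<in> Hom T Y Z \<Longrightarrow>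
      g \<cdot> add_arr T f f' = add_arr T (g \<cdot> f) (g \<cdot> f')"

text \<open>\<open>C\<close> is a direct sum of \<open>X\<close> and \<open>Y\<close> with injections \<open>a\<close>, \<open>b\<close> and projections \<open>p\<close>, \<open>q\<close>.\<close>

definition biproduct ::
  "('o, 'm, 'z) preadditive_category_scheme \<Rightarrow> 'o \<Rightarrow> 'o \<Rightarrow> 'o \<Rightarrow> 'm \<Rightarrow> 'm \<Rightarrow> 'm \<Rightarrow> 'm \<Rightarrow> bool" where
  "biproduct T X Y C a b p q \<longleftrightarrow>
     a \<in> Hom T X C \<and> b \<in> Hom T Y C \<and> p \<in> Hom T C X \<and> q \<in> Hom T C Y \<and>
     p \<cdot>\<^bsub>T\<^esub> a = idn T X \<and> q \<cdot>\<^bsub>T\<^esub> b = idn T Y \<and>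
     p \<cdot>\<^bsub>T\<^esub> b = zero_arr T Y X \<and> q \<cdot>\<^bsub>T\<^esub> a = zero_arr T X Y \<and>
     add_arr T (a \<cdot>\<^bsub>T\<^esub> p) (b \<cdot>\<^bsub>T\<^esub> q) = idn T C"

locale additive_category = preadditive_category T
  for T :: "('o, 'm, 'z) preadditive_category_scheme" (structure) +
  assumes ex_zero_object: "\<exists>Z. zero_object T Z"
    and ex_biproduct: "X \<in> obj T \<Longrightarrow> Y \<in> obj T \<Longrightarrow>
      \<exists>C \<in> obj T. \<exists>a b p q. biproduct T X Y C a b p q"

section \<open>n-angulated categories\<close>

text \<open>A sequence \<open>A\<^sub>1 \<rightarrow> A\<^sub>2 \<rightarrow> \<dots> \<rightarrow> A\<^sub>n \<rightarrow> \<Sigma> A\<^sub>1\<close> is the list \<open>\<alpha>\<close> of its \<open>n\<close> morphisms,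
  so \<open>\<alpha>\<^sub>i\<close> is \<open>\<alpha> ! (i - 1)\<close> and \<open>A\<^sub>i\<close> is its source. Likewise a morphism of sequences is the list of its \<open>n\<close> components.\<close>

record ('o, 'm) angulated_category = "('o, 'm) preadditive_category" +
  susp_obj :: "'o \<Rightarrow> 'o"
  susp     :: "'m \<Rightarrow> 'm"
  angles   :: "'m list set"

locale suspended_category = additive_category T
  for T :: "('o, 'm, 'z) angulated_category_scheme" (structure) +
  assumes susp_obj_bij: "bij_betw (susp_obj T) (obj T) (obj T)"
    and susp_bij: "bij_betw (susp T) (arr T) (arr T)"
    and susp_src: "f \<in> arr T \<Longrightarrow> src T (susp T f) = susp_obj T (src T f)"
    and susp_tgt: "f \<in> arr T \<Longrightarrow> tgt T (susp T f) = susp_obj T (tgt T f)"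
    and susp_idn: "X \<in> obj T \<Longrightarrow> susp T (idn T X) = idn T (susp_obj T X)"
    and susp_comp: "f \<in> Hom T X Y \<Longrightarrow> g \<in> Hom T Y Z \<Longrightarrow> susp T (g \<cdot> f) = susp T g \<cdot> susp T f"
    and susp_add: "f \<in> Hom T X Y \<Longrightarrow> g \<in> Hom T X Y \<Longrightarrow>
      susp T (add_arr T f g) = add_arr T (susp T f) (susp T g)"

definition n_sequence :: "('o, 'm, 'z) angulated_category_scheme \<Rightarrow> nat \<Rightarrow> 'm list \<Rightarrow> bool" where
  "n_sequence T n \<alpha> \<longleftrightarrow>
     length \<alpha> = n \<and> set \<alpha> \<subseteq> arr T \<and>
     (\<forall>k. Suc k < n \<longrightarrow> tgt T (\<alpha> ! k) = src T (\<alpha> ! Suc k)) \<and>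
     tgt T (last \<alpha>) = susp_obj T (src T (hd \<alpha>))"

definition seq_morphism ::
  "('o, 'm, 'z) angulated_category_scheme \<Rightarrow> nat \<Rightarrow> 'm list \<Rightarrow> 'm list \<Rightarrow> 'm list \<Rightarrow> bool" where
  "seq_morphism T n \<alpha> \<beta> \<phi> \<longleftrightarrow>
     n_sequence T n \<alpha> \<and> n_sequence T n \<beta> \<and> length \<phi> = n \<and>
     (\<forall>k<n. \<phi> ! k \<in> Hom T (src T (\<alpha> ! k)) (src T (\<beta> ! k))) \<and>
     (\<forall>k. Suc k < n \<longrightarrow> \<phi> ! Suc k \<cdot>\<^bsub>T\<^esub> \<alpha> ! k = \<beta> ! k \<cdot>\<^bsub>T\<^esub> \<phi> ! k) \<and>
     susp T (hd \<phi>) \<cdot>\<^bsub>T\<^esub> last \<alpha> = last \<beta> \<cdot>\<^bsub>T\<^esub> last \<phi>"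

text \<open>\<open>\<gamma>\<close> is a direct sum of the sequences \<open>\<alpha>\<close> and \<open>\<beta>\<close>; as for objects, this is a notion up to
  isomorphism.\<close>

definition seq_direct_sum ::
  "('o, 'm, 'z) angulated_category_scheme \<Rightarrow> nat \<Rightarrow> 'm list \<Rightarrow> 'm list \<Rightarrow> 'm list \<Rightarrow> bool" where
  "seq_direct_sum T n \<alpha> \<beta> \<gamma> \<longleftrightarrow>
     (\<exists>a b p q. seq_morphism T n \<alpha> \<gamma> a \<and> seq_morphism T n \<beta> \<gamma> b \<and>
        seq_morphism T n \<gamma> \<alpha> p \<and> seq_morphism T n \<gamma> \<beta> q \<and>
        (\<forall>k<n. biproduct T (src T (\<alpha> ! k)) (src T (\<beta> ! k)) (src T (\<gamma> ! k))
                  (a ! k) (b ! k) (p ! k) (q ! k)))"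

definition trivial_sequence ::
  "('o, 'm, 'z) angulated_category_scheme \<Rightarrow> nat \<Rightarrow> 'o \<Rightarrow> 'o \<Rightarrow> 'm list" where
  "trivial_sequence T n X Z =
     [idn T X, zero_arr T X Z] @ replicate (n - 3) (zero_arr T Z Z) @ [zero_arr T Z (susp_obj T X)]"

definition left_rotation :: "('o, 'm, 'z) angulated_category_scheme \<Rightarrow> nat \<Rightarrow> 'm list \<Rightarrow> 'm list" where
  "left_rotation T n \<alpha> =
     tl \<alpha> @ [if even n then susp T (hd \<alpha>) else neg_arr T (susp T (hd \<alpha>))]"

definition shift :: "('o, 'm, 'z) angulated_category_scheme \<Rightarrow> 'm list \<Rightarrow> 'm list" where
  "shift T \<alpha> = tl \<alpha> @ [susp T (hd \<alpha>)]"

text \<open>The sequence \<open>\<gamma>\<close> is a mapping cone of the morphism \<open>\<phi>\<close> from \<open>\<alpha>\<close> to \<open>\<beta>\<close>. Its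
  \<open>k\<close>-th object (counting from \<open>0\<close>) is a direct sum of those of \<open>shift T \<alpha>\<close> and \<open>\<beta>\<close>, with
  injections \<open>a k\<close>, \<open>b k\<close> and projections \<open>p k\<close>, \<open>q k\<close>; the structure maps at index \<open>n\<close> exhibit
  the last target \<open>\<Sigma>A\<^sub>2 \<oplus> \<Sigma>B\<^sub>1\<close> as the suspension of the first object. The last condition
  gives the entries of the matrix of \<open>\<gamma> ! k\<close>.\<close>

definition is_cone ::
  "('o, 'm, 'z) angulated_category_scheme \<Rightarrow> nat \<Rightarrow> 'm list \<Rightarrow> 'm list \<Rightarrow> 'm list \<Rightarrow> 'm list \<Rightarrow> bool" where
  "is_cone T n \<alpha> \<beta> \<phi> \<gamma> \<longleftrightarrow>
     n_sequence T n \<gamma> \<and>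
     (\<exists>a b p q :: nat \<Rightarrow> 'm.
        (\<forall>k<n. biproduct T (src T (shift T \<alpha> ! k)) (src T (\<beta> ! k)) (src T (\<gamma> ! k))
                  (a k) (b k) (p k) (q k)) \<and>
        a n = susp T (a 0) \<and> b n = susp T (b 0) \<and> p n = susp T (p 0) \<and> q n = susp T (q 0) \<and>
        (\<forall>k<n.
           p (Suc k) \<cdot>\<^bsub>T\<^esub> \<gamma> ! k \<cdot>\<^bsub>T\<^esub> a k = neg_arr T (shift T \<alpha> ! k) \<and>
           p (Suc k) \<cdot>\<^bsub>T\<^esub> \<gamma> ! k \<cdot>\<^bsub>T\<^esub> b k = zero_arr T (src T (\<beta> ! k)) (tgt T (shift T \<alpha> ! k)) \<and>
           q (Suc k) \<cdot>\<^bsub>T\<^esub> \<gamma> ! k \<cdot>\<^bsub>T\<^esub> a k = shift T \<phi> ! k \<and>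
           q (Suc k) \<cdot>\<^bsub>T\<^esub> \<gamma> ! k \<cdot>\<^bsub>T\<^esub> b k = \<beta> ! k))"

locale n_angulated_category = suspended_category T
  for T :: "('o, 'm, 'z) angulated_category_scheme" (structure) +
  fixes n :: nat
  assumes n_ge_3: "n \<ge> 3"
    and angles_sequence: "\<alpha> \<in> angles T \<Longrightarrow> n_sequence T n \<alpha>"
    and F1_sum: "\<alpha> \<in> angles T \<Longrightarrow> \<beta> \<in> angles T \<Longrightarrow> seq_direct_sum T n \<alpha> \<beta> \<gamma> \<Longrightarrow> \<gamma> \<in> angles T"
    and F1_summand: "\<gamma> \<in> angles T \<Longrightarrow> seq_direct_sum T n \<alpha> \<beta> \<gamma> \<Longrightarrow> \<alpha> \<in> angles T \<and> \<beta> \<in> angles T"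
    and F1_trivial: "X \<in> obj T \<Longrightarrow> zero_object T Z \<Longrightarrow> trivial_sequence T n X Z \<in> angles T"
    and F1_complete: "f \<in> arr T \<Longrightarrow> \<exists>\<alpha> \<in> angles T. hd \<alpha> = f"
    and F2: "n_sequence T n \<alpha> \<Longrightarrow> \<alpha> \<in> angles T \<longleftrightarrow> left_rotation T n \<alpha> \<in> angles T"
    and F3: "\<alpha> \<in> angles T \<Longrightarrow> \<beta> \<in> angles T \<Longrightarrow>
      f\<^sub>1 \<in> Hom T (src T (\<alpha> ! 0)) (src T (\<beta> ! 0)) \<Longrightarrow>
      f\<^sub>2 \<in> Hom T (src T (\<alpha> ! 1)) (src T (\<beta> ! 1)) \<Longrightarrow>
      f\<^sub>2 \<cdot> \<alpha> ! 0 = \<beta> ! 0 \<cdot> f\<^sub>1 \<Longrightarrow>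
      \<exists>\<phi>. seq_morphism T n \<alpha> \<beta> \<phi> \<and> \<phi> ! 0 = f\<^sub>1 \<and> \<phi> ! 1 = f\<^sub>2"
    and F4: "\<alpha> \<in> angles T \<Longrightarrow> \<beta> \<in> angles T \<Longrightarrow>
      f\<^sub>1 \<in> Hom T (src T (\<alpha> ! 0)) (src T (\<beta> ! 0)) \<Longrightarrow>
      f\<^sub>2 \<in> Hom T (src T (\<alpha> ! 1)) (src T (\<beta> ! 1)) \<Longrightarrow>
      f\<^sub>2 \<cdot> \<alpha> ! 0 = \<beta> ! 0 \<cdot> f\<^sub>1 \<Longrightarrow>
      \<exists>\<phi> \<gamma>. seq_morphism T n \<alpha> \<beta> \<phi> \<and> \<phi> ! 0 = f\<^sub>1 \<and> \<phi> ! 1 = f\<^sub>2 \<and>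
            is_cone T n \<alpha> \<beta> \<phi> \<gamma> \<and> \<gamma> \<in> angles T"

section \<open>Almost n-exact structures\<close>

text \<open>A full subcategory is given by its set \<open>A\<close> of objects.\<close>

definition arr_in :: "('o, 'm, 'z) category_scheme \<Rightarrow> 'o set \<Rightarrow> 'm set" where
  "arr_in T A = {f \<in> arr T. src T f \<in> A \<and> tgt T f \<in> A}"

definition ext_closed_subcategory ::
  "('o, 'm, 'z) angulated_category_scheme \<Rightarrow> 'o set \<Rightarrow> bool" where
  "ext_closed_subcategory T A \<longleftrightarrow>
     A \<subseteq> obj T \<and>
     (\<forall>X \<in> A. \<forall>Y \<in> obj T. isomorphic T X Y \<longrightarrow> Y \<in> A) \<and>
     (\<forall>\<alpha> \<in> angles T. src T (hd \<alpha>) \<in> A \<and> src T (last \<alpha>) \<in> A \<longrightarrow> (\<forall>f \<in> set \<alpha>. src T f \<in> A))"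

definition angles_in :: "('o, 'm, 'z) angulated_category_scheme \<Rightarrow> 'o set \<Rightarrow> 'm list set" where
  "angles_in T A = {\<alpha> \<in> angles T. \<forall>f \<in> set \<alpha>. src T f \<in> A}"

definition split_angle :: "('o, 'm, 'z) angulated_category_scheme \<Rightarrow> 'm list \<Rightarrow> bool" where
  "split_angle T \<alpha> \<longleftrightarrow>
     \<alpha> \<in> angles T \<and> last \<alpha> = zero_arr T (src T (last \<alpha>)) (tgt T (last \<alpha>))"

locale almost_n_exact_structure =
  fixes T :: "('o, 'm, 'z) angulated_category_scheme" (structure)
    and n :: nat and A :: "'o set" and E :: "'m list set"
  assumes E_angles: "E \<subseteq> angles_in T A"
    and N1_sum: "\<alpha> \<in> E \<Longrightarrow> \<beta> \<in> E \<Longrightarrow> seq_direct_sum T n \<alpha> \<beta> \<gamma> \<Longrightarrow> \<gamma> \<in> E"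
    and N1_split: "\<alpha> \<in> angles_in T A \<Longrightarrow> split_angle T \<alpha> \<Longrightarrow> \<alpha> \<in> E"
    and N2: "\<alpha> \<in> E \<Longrightarrow> f \<in> arr_in T A \<Longrightarrow> tgt T f = src T (last \<alpha>) \<Longrightarrow>
      \<beta> \<in> angles T \<Longrightarrow> last \<beta> = last \<alpha> \<cdot> f \<Longrightarrow>
      seq_morphism T n \<beta> \<alpha> \<phi> \<Longrightarrow> hd \<phi> = idn T (src T (hd \<alpha>)) \<Longrightarrow> last \<phi> = f \<Longrightarrow> \<beta> \<in> E"
    and N3: "\<alpha> \<in> E \<Longrightarrow> g \<in> arr_in T A \<Longrightarrow> src T g = src T (hd \<alpha>) \<Longrightarrow>
      \<beta> \<in> angles T \<Longrightarrow> last \<beta> = susp T g \<cdot> last \<alpha> \<Longrightarrow>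
      seq_morphism T n \<alpha> \<beta> \<phi> \<Longrightarrow> hd \<phi> = g \<Longrightarrow> last \<phi> = idn T (src T (last \<alpha>)) \<Longrightarrow> \<beta> \<in> E"

definition inflations :: "'m list set \<Rightarrow> 'm set" where
  "inflations E = hd ` E"

definition deflations :: "nat \<Rightarrow> 'm list set \<Rightarrow> 'm set" where
  "deflations n E = (\<lambda>\<alpha>. \<alpha> ! (n - 2)) ` E"

definition phantoms :: "'m list set \<Rightarrow> 'm set" where
  "phantoms E = last ` E"

definition E_projective ::
  "('o, 'm, 'z) angulated_category_scheme \<Rightarrow> nat \<Rightarrow> 'o set \<Rightarrow> 'm list set \<Rightarrow> 'm \<Rightarrow> bool" where
  "E_projective T n A E f \<longleftrightarrow>
     f \<in> arr_in T A \<and>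
     (\<forall>d \<in> deflations n E. tgt T d = tgt T f \<longrightarrow>
        (\<exists>h \<in> Hom T (src T f) (src T d). f = d \<cdot>\<^bsub>T\<^esub> h))"

definition E_injective ::
  "('o, 'm, 'z) angulated_category_scheme \<Rightarrow> 'o set \<Rightarrow> 'm list set \<Rightarrow> 'm \<Rightarrow> bool" where
  "E_injective T A E g \<longleftrightarrow>
     g \<in> arr_in T A \<and>
     (\<forall>e \<in> inflations E. src T e = src T g \<longrightarrow>
        (\<exists>h \<in> Hom T (tgt T e) (tgt T g). g = h \<cdot>\<^bsub>T\<^esub> e))"

definition enough_injective_morphisms ::
  "('o, 'm, 'z) angulated_category_scheme \<Rightarrow> 'o set \<Rightarrow> 'm list set \<Rightarrow> bool" where
  "enough_injective_morphisms T A E \<longleftrightarrow>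
     (\<forall>X \<in> A. \<exists>e \<in> inflations E. src T e = X \<and> E_injective T A E e)"

definition enough_projective_morphisms ::
  "('o, 'm, 'z) angulated_category_scheme \<Rightarrow> nat \<Rightarrow> 'o set \<Rightarrow> 'm list set \<Rightarrow> bool" where
  "enough_projective_morphisms T n A E \<longleftrightarrow>
     (\<forall>X \<in> A. \<exists>d \<in> deflations n E. tgt T d = X \<and> E_projective T n A E d)"

section \<open>Ideals, precovers and preenvelopes\<close>

definition ideal_in :: "('o, 'm, 'z) preadditive_category_scheme \<Rightarrow> 'o set \<Rightarrow> 'm set \<Rightarrow> bool" where
  "ideal_in T A I \<longleftrightarrow>
     I \<subseteq> arr_in T A \<and>
     (\<forall>X \<in> A. \<forall>Y \<in> A. subgroup (I \<inter> Hom T X Y) (hom_group T X Y)) \<and>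
     (\<forall>f \<in> I. \<forall>g \<in> arr_in T A. src T g = tgt T f \<longrightarrow> g \<cdot>\<^bsub>T\<^esub> f \<in> I) \<and>
     (\<forall>f \<in> I. \<forall>g \<in> arr_in T A. tgt T g = src T f \<longrightarrow> f \<cdot>\<^bsub>T\<^esub> g \<in> I)"

definition precover :: "('o, 'm, 'z) category_scheme \<Rightarrow> 'm set \<Rightarrow> 'o \<Rightarrow> 'm \<Rightarrow> bool" where
  "precover T I X i \<longleftrightarrow>
     i \<in> I \<and> tgt T i = X \<and>
     (\<forall>i' \<in> I. tgt T i' = X \<longrightarrow> (\<exists>h \<in> Hom T (src T i') (src T i). i' = i \<cdot>\<^bsub>T\<^esub> h))"

definition preenvelope :: "('o, 'm, 'z) category_scheme \<Rightarrow> 'm set \<Rightarrow> 'o \<Rightarrow> 'm \<Rightarrow> bool" where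
  "preenvelope T J X j \<longleftrightarrow>
     j \<in> J \<and> src T j = X \<and>
     (\<forall>j' \<in> J. src T j' = X \<longrightarrow> (\<exists>h \<in> Hom T (tgt T j) (tgt T j'). j' = h \<cdot>\<^bsub>T\<^esub> j))"

definition precovering_ideal ::
  "('o, 'm, 'z) preadditive_category_scheme \<Rightarrow> 'o set \<Rightarrow> 'm set \<Rightarrow> bool" where
  "precovering_ideal T A I \<longleftrightarrow> ideal_in T A I \<and> (\<forall>X \<in> A. \<exists>i. precover T I X i)"

definition preenveloping_ideal ::
  "('o, 'm, 'z) preadditive_category_scheme \<Rightarrow> 'o set \<Rightarrow> 'm set \<Rightarrow> bool" where
  "preenveloping_ideal T A J \<longleftrightarrow> ideal_in T A J \<and> (\<forall>X \<in> A. \<exists>j. preenvelope T J X j)"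

section \<open>Orthogonality\<close>

definition orthogonal ::
  "('o, 'm, 'z) angulated_category_scheme \<Rightarrow> 'm list set \<Rightarrow> 'm \<Rightarrow> 'm \<Rightarrow> bool" where
  "orthogonal T E f g \<longleftrightarrow>
     (\<forall>\<phi> \<in> phantoms E. src T \<phi> = tgt T f \<and> tgt T \<phi> = susp_obj T (src T g) \<longrightarrow>
        susp T g \<cdot>\<^bsub>T\<^esub> \<phi> \<cdot>\<^bsub>T\<^esub> f = zero_arr T (src T f) (susp_obj T (tgt T g)))"

definition right_perp ::
  "('o, 'm, 'z) angulated_category_scheme \<Rightarrow> 'o set \<Rightarrow> 'm list set \<Rightarrow> 'm set \<Rightarrow> 'm set" where
  "right_perp T A E M = {g \<in> arr_in T A. \<forall>m \<in> M. orthogonal T E m g}"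

definition left_perp ::
  "('o, 'm, 'z) angulated_category_scheme \<Rightarrow> 'o set \<Rightarrow> 'm list set \<Rightarrow> 'm set \<Rightarrow> 'm set" where
  "left_perp T A E M = {g \<in> arr_in T A. \<forall>m \<in> M. orthogonal T E g m}"

text \<open>The n-angle on a given morphism is unique only up to (non-unique) morphisms, so ``the
  corresponding n-angle'' is read as the existence of an n-angle with the stated last morphism.\<close>

definition special_precover ::
  "('o, 'm, 'z) angulated_category_scheme \<Rightarrow> nat \<Rightarrow> 'o set \<Rightarrow> 'm list set \<Rightarrow> 'm set \<Rightarrow> 'o \<Rightarrow> 'm \<Rightarrow> bool" where
  "special_precover T n A E I X i \<longleftrightarrow>
     i \<in> I \<and> tgt T i = X \<and>
     (\<exists>\<alpha> \<in> angles T. \<alpha> ! (n - 2) = i \<and>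
        (\<exists>j \<in> right_perp T A E I. \<exists>\<phi> \<in> phantoms E.
           src T \<phi> = X \<and> tgt T \<phi> = susp_obj T (src T j) \<and> last \<alpha> = susp T j \<cdot>\<^bsub>T\<^esub> \<phi>))"

definition special_preenvelope ::
  "('o, 'm, 'z) angulated_category_scheme \<Rightarrow> 'o set \<Rightarrow> 'm list set \<Rightarrow> 'm set \<Rightarrow> 'o \<Rightarrow> 'm \<Rightarrow> bool" where
  "special_preenvelope T A E J X j \<longleftrightarrow>
     j \<in> J \<and> src T j = X \<and>
     (\<exists>\<alpha> \<in> angles T. hd \<alpha> = j \<and>
        (\<exists>i \<in> left_perp T A E J. \<exists>\<phi> \<in> phantoms E.
           src T i = src T (last \<alpha>) \<and> src T \<phi> = tgt T i \<and> tgt T \<phi> = susp_obj T X \<and>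
           last \<alpha> = \<phi> \<cdot>\<^bsub>T\<^esub> i))"

definition special_precovering_ideal ::
  "('o, 'm, 'z) angulated_category_scheme \<Rightarrow> nat \<Rightarrow> 'o set \<Rightarrow> 'm list set \<Rightarrow> 'm set \<Rightarrow> bool" where
  "special_precovering_ideal T n A E I \<longleftrightarrow>
     ideal_in T A I \<and> (\<forall>X \<in> A. \<exists>i. special_precover T n A E I X i)"

definition special_preenveloping_ideal ::
  "('o, 'm, 'z) angulated_category_scheme \<Rightarrow> 'o set \<Rightarrow> 'm list set \<Rightarrow> 'm set \<Rightarrow> bool" where
  "special_preenveloping_ideal T A E J \<longleftrightarrow>
     ideal_in T A J \<and> (\<forall>X \<in> A. \<exists>j. special_preenvelope T A E J X j)"

end

(* For an E-injective inflation X -> E_2 with phantom phi : Y -> Sigma X and an I-precover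
   i : W -> Y, base change of phi along i gives an n-angle in E starting with some j : X -> B_2.
   Injectivity makes every phantom into Sigma X factor through phi, so its composite with a
   morphism of I factors through phi i, which Sigma j kills. Hence j lies in the right
   orthogonal of I and is the required special preenvelope. The second half is dual. *)

theory Submission
  imports Defs
begin

text \<open>The obstacle is one of position: (F1) and (F3) speak about the first morphisms of
  n-angles, while phantoms are last morphisms and deflations are next to last. Rotation bridges the
  gap. It turns the fill-in axiom into versions for any consecutive square (\<open>F3_at\<close>)
  and for the wrap-around square (\<open>F3_last\<close>), and it completes a given morphism to an
  n-angle that ends with it (\<open>ex_angle_last\<close>). The price is desuspending components and
  cancelling the sign (-1)^n; this is why bijectivity of the suspension on objects and arrows is
  used throughout. Two further points complete the argument. Orthogonals are ideals because (N2) and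
  (N3) make phantoms stable under composition with morphisms of \<open>A\<close> on both sides. A
  special preenvelope of the right orthogonal of \<open>I\<close> also asks for a factor of its
  phantom in the left orthogonal of that orthogonal, and the precover serves because
  \<open>I\<close> lies in its own double orthogonal.\<close>

context category
begin

lemma HomD:
  assumes "f \<in> Hom T X Y"
  shows "f \<in> arr T" "src T f = X" "tgt T f = Y" "X \<in> obj T" "Y \<in> obj T"
  using assms src_obj tgt_obj by (auto simp: Hom_def)

lemma arr_Hom: "f \<in> arr T \<Longrightarrow> f \<in> Hom T (src T f) (tgt T f)"
  by (simp add: Hom_def)

end

section \<open>Zero morphisms, negatives and bilinearity\<close>

context preadditive_category
begin

lemma group_Hom: "X \<in> obj T \<Longrightarrow> Y \<in> obj T \<Longrightarrow> group (hom_group T X Y)"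
  using comm_group_Hom by (simp add: comm_group_def)

lemma zero_Hom: "X \<in> obj T \<Longrightarrow> Y \<in> obj T \<Longrightarrow> zero_arr T X Y \<in> Hom T X Y"
  using group.is_monoid[OF group_Hom, of X Y] monoid.one_closed
  by (fastforce simp: hom_group_def)

lemma add_Hom: "f \<in> Hom T X Y \<Longrightarrow> g \<in> Hom T X Y \<Longrightarrow> add_arr T f g \<in> Hom T X Y"
  using group.is_monoid[OF group_Hom, of X Y] monoid.m_closed[of "hom_group T X Y" f g] HomD(4,5)[of f X Y]
  by (simp add: hom_group_def)

lemma add_zero: "X \<in> obj T \<Longrightarrow> Y \<in> obj T \<Longrightarrow>
    add_arr T (zero_arr T X Y) (zero_arr T X Y) = zero_arr T X Y"
  using group.is_monoid[OF group_Hom, of X Y] monoid.l_one[of "hom_group T X Y" "zero_arr T X Y"]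
    zero_Hom[of X Y]
  by (simp add: hom_group_def)

text \<open>The only idempotent of a group is its neutral element. This criterion derives the
  absorption laws for zero morphisms from bilinearity, and the preservation of zero from additivity
  of the suspension.\<close>

lemma idem_zero: "f \<in> Hom T X Y \<Longrightarrow> add_arr T f f = f \<Longrightarrow> f = zero_arr T X Y"
  using group.r_cancel_one[OF group_Hom, of X Y f f] HomD(4,5)[of f X Y]
  by (simp add: hom_group_def)

lemma zero_comp:
  assumes "f \<in> Hom T X Y" "Z \<in> obj T"
  shows "zero_arr T Y Z \<cdot> f = zero_arr T X Z"
proof -
  have z: "zero_arr T Y Z \<in> Hom T Y Z" using assms HomD zero_Hom by blast
  show ?thesis
    using idem_zero[OF comp_Hom[OF assms(1) z]] comp_add_left[OF assms(1) z z] add_zero HomD(5)[OF assms(1)]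
      assms(2) by simp
qed

lemma comp_zero:
  assumes "f \<in> Hom T Y Z" "X \<in> obj T"
  shows "f \<cdot> zero_arr T X Y = zero_arr T X Z"
proof -
  have z: "zero_arr T X Y \<in> Hom T X Y" using assms HomD zero_Hom by blast
  show ?thesis
    using idem_zero[OF comp_Hom[OF z assms(1)]] comp_add_right[OF z z assms(1)] add_zero HomD(4)[OF assms(1)]
      assms(2) by simp
qed

lemma neg_Hom: "f \<in> Hom T X Y \<Longrightarrow> neg_arr T f \<in> Hom T X Y"
  using group.inv_closed[OF group_Hom, of X Y f] HomD[of f X Y]
  by (simp add: hom_group_def neg_arr_def)

lemma neg_neg: "f \<in> Hom T X Y \<Longrightarrow> neg_arr T (neg_arr T f) = f"
  using group.inv_inv[OF group_Hom, of X Y f] HomD[of f X Y] HomD(2,3)[OF neg_Hom, of f X Y]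
  by (simp add: hom_group_def neg_arr_def)

lemma add_neg: "f \<in> Hom T X Y \<Longrightarrow> add_arr T (neg_arr T f) f = zero_arr T X Y"
  using group.l_inv[OF group_Hom, of X Y f] HomD[of f X Y]
  by (simp add: hom_group_def neg_arr_def)

lemma neg_unique:
  "f \<in> Hom T X Y \<Longrightarrow> g \<in> Hom T X Y \<Longrightarrow> add_arr T g f = zero_arr T X Y \<Longrightarrow> g = neg_arr T f"
  using group.inv_equality[OF group_Hom, of X Y g f] HomD[of f X Y]
  by (simp add: hom_group_def neg_arr_def)

lemma neg_zero: "X \<in> obj T \<Longrightarrow> Y \<in> obj T \<Longrightarrow> neg_arr T (zero_arr T X Y) = zero_arr T X Y"
  using neg_unique[OF zero_Hom zero_Hom, of X Y] add_zero by simp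

lemma neg_comp:
  assumes "f \<in> Hom T X Y" "g \<in> Hom T Y Z"
  shows "neg_arr T g \<cdot> f = neg_arr T (g \<cdot> f)"
proof (rule neg_unique)
  show "add_arr T (neg_arr T g \<cdot> f) (g \<cdot> f) = zero_arr T X Z"
    using comp_add_left[OF assms(1) neg_Hom[OF assms(2)] assms(2)] add_neg[OF assms(2)]
      zero_comp[OF assms(1)] HomD[OF assms(2)] by simp
qed (use assms neg_Hom comp_Hom in blast)+

lemma comp_neg:
  assumes "f \<in> Hom T X Y" "g \<in> Hom T Y Z"
  shows "g \<cdot> neg_arr T f = neg_arr T (g \<cdot> f)"
proof (rule neg_unique)
  show "add_arr T (g \<cdot> neg_arr T f) (g \<cdot> f) = zero_arr T X Z"
    using comp_add_right[OF neg_Hom[OF assms(1)] assms(1) assms(2)] add_neg[OF assms(1)]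
      comp_zero[OF assms(2)] HomD[OF assms(1)] by simp
qed (use assms neg_Hom comp_Hom in blast)+

lemma subgroup_HomI:
  assumes "X \<in> obj T" "Y \<in> obj T" and "zero_arr T X Y \<in> M"
    and "\<And>f g. f \<in> M \<inter> Hom T X Y \<Longrightarrow> g \<in> M \<inter> Hom T X Y \<Longrightarrow> add_arr T f g \<in> M"
    and "\<And>f. f \<in> M \<inter> Hom T X Y \<Longrightarrow> neg_arr T f \<in> M"
  shows "subgroup (M \<inter> Hom T X Y) (hom_group T X Y)"
proof (rule group.subgroupI[OF group_Hom[OF assms(1,2)]])
  fix f assume f: "f \<in> M \<inter> Hom T X Y"
  \<comment> \<open>\<open>neg_arr\<close> reads its group off the source and target of the
    morphism, so inside a fixed morphism set it is the inverse of that group.\<close>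
  then have "inv\<^bsub>hom_group T X Y\<^esub> f = neg_arr T f" by (auto simp: neg_arr_def Hom_def)
  then show "inv\<^bsub>hom_group T X Y\<^esub> f \<in> M \<inter> Hom T X Y" using f assms(5) neg_Hom by auto
qed (use assms zero_Hom add_Hom in \<open>auto simp: hom_group_def\<close>)

end

section \<open>The suspension as an automorphism, sequences and a single rotation\<close>

context suspended_category
begin

lemma susp_Hom: "f \<in> Hom T X Y \<Longrightarrow> susp T f \<in> Hom T (susp_obj T X) (susp_obj T Y)"
  using susp_bij susp_src susp_tgt by (auto simp: Hom_def bij_betw_def)

lemma susp_obj_in: "X \<in> obj T \<Longrightarrow> susp_obj T X \<in> obj T"
  using susp_obj_bij by (auto simp: bij_betw_def)

lemma susp_obj_inj: "susp_obj T X = susp_obj T Y \<Longrightarrow> X \<in> obj T \<Longrightarrow> Y \<in> obj T \<Longrightarrow> X = Y"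
  using susp_obj_bij by (auto simp: bij_betw_def inj_on_def)

lemma susp_inj: "susp T f = susp T g \<Longrightarrow> f \<in> arr T \<Longrightarrow> g \<in> arr T \<Longrightarrow> f = g"
  using susp_bij by (auto simp: bij_betw_def inj_on_def)

text \<open>Bijectivity is assumed only on the set of all arrows. Injectivity on objects then pins
  down the source and target of the preimage, which gives fullness.\<close>

lemma susp_surj:
  assumes "f \<in> Hom T (susp_obj T X) (susp_obj T Y)" "X \<in> obj T" "Y \<in> obj T"
  obtains g where "g \<in> Hom T X Y" "susp T g = f"
proof -
  obtain g where g: "g \<in> arr T" "susp T g = f"
    using assms(1) susp_bij unfolding Hom_def bij_betw_def by (metis (mono_tags, lifting) image_iff mem_Collect_eq)
  then have "susp_obj T (src T g) = susp_obj T X" "susp_obj T (tgt T g) = susp_obj T Y"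
    using assms(1) susp_src susp_tgt by (auto simp: Hom_def)
  then have "g \<in> Hom T X Y" using susp_obj_inj assms src_obj tgt_obj g by (auto simp: Hom_def)
  then show ?thesis using g that by blast
qed

lemma susp_zero:
  assumes "X \<in> obj T" "Y \<in> obj T"
  shows "susp T (zero_arr T X Y) = zero_arr T (susp_obj T X) (susp_obj T Y)"
  using idem_zero[OF susp_Hom[OF zero_Hom[OF assms]]] susp_add[OF zero_Hom zero_Hom] add_zero assms
  by simp

lemma susp_neg:
  assumes "f \<in> Hom T X Y"
  shows "susp T (neg_arr T f) = neg_arr T (susp T f)"
  using neg_unique[OF susp_Hom susp_Hom, of f X Y "neg_arr T f"] susp_add[OF neg_Hom, of f X Y f]
    susp_zero add_neg assms HomD neg_Hom by metis

lemma n_sequenceD: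
  assumes "n_sequence T n \<alpha>" "n \<ge> 3"
  shows "length \<alpha> = n" "k < n \<Longrightarrow> \<alpha> ! k \<in> arr T" "k < n \<Longrightarrow> src T (\<alpha> ! k) \<in> obj T"
    "Suc k < n \<Longrightarrow> \<alpha> ! k \<in> Hom T (src T (\<alpha> ! k)) (src T (\<alpha> ! Suc k))"
    "\<alpha> ! (n - 1) \<in> Hom T (src T (\<alpha> ! (n - 1))) (susp_obj T (src T (\<alpha> ! 0)))"
    "hd \<alpha> = \<alpha> ! 0" "last \<alpha> = \<alpha> ! (n - 1)"
proof -
  show l: "length \<alpha> = n" using assms by (simp add: n_sequence_def)
  show a: "\<alpha> ! k \<in> arr T" if "k < n" for k using assms that l by (auto simp: n_sequence_def)
  then show "k < n \<Longrightarrow> src T (\<alpha> ! k) \<in> obj T" by (simp add: src_obj)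
  show "Suc k < n \<Longrightarrow> \<alpha> ! k \<in> Hom T (src T (\<alpha> ! k)) (src T (\<alpha> ! Suc k))"
    using a assms by (simp add: Hom_def n_sequence_def)
  show h: "hd \<alpha> = \<alpha> ! 0" using l assms(2) by (metis hd_conv_nth list.size(3) not_numeral_le_zero)
  show t: "last \<alpha> = \<alpha> ! (n - 1)" using l assms(2) by (metis last_conv_nth list.size(3) not_numeral_le_zero)
  show "\<alpha> ! (n - 1) \<in> Hom T (src T (\<alpha> ! (n - 1))) (susp_obj T (src T (\<alpha> ! 0)))"
    using a assms h t by (simp add: Hom_def n_sequence_def)
qed

lemma n_sequenceI:
  assumes "n \<ge> 3" "length \<alpha> = n"
    and "\<And>k. Suc k < n \<Longrightarrow> \<alpha> ! k \<in> Hom T (src T (\<alpha> ! k)) (src T (\<alpha> ! Suc k))"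
    and "\<alpha> ! (n - 1) \<in> Hom T (src T (\<alpha> ! (n - 1))) (susp_obj T (src T (\<alpha> ! 0)))"
  shows "n_sequence T n \<alpha>"
proof -
  have "\<alpha> \<noteq> []" using assms by auto
  moreover have "\<alpha> ! k \<in> arr T" if "k < n" for k
    using assms(3)[of k] assms(4) that by (cases "Suc k < n") (auto simp: Hom_def not_less_eq less_Suc_eq le_Suc_eq dest: HomD)
  then have "set \<alpha> \<subseteq> arr T" using assms(2) by (auto simp: in_set_conv_nth)
  ultimately show ?thesis using assms by (auto simp: n_sequence_def hd_conv_nth last_conv_nth Hom_def)
qed

lemma left_rotation_nth:
  assumes "n_sequence T n \<alpha>" "n \<ge> 3"
  shows "length (left_rotation T n \<alpha>) = n"
    "Suc k < n \<Longrightarrow> left_rotation T n \<alpha> ! k = \<alpha> ! Suc k"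
    "left_rotation T n \<alpha> ! (n - 1) = (if even n then susp T (\<alpha> ! 0) else neg_arr T (susp T (\<alpha> ! 0)))"
  using n_sequenceD[OF assms] assms(2)
  by (auto simp: left_rotation_def nth_append nth_tl)

lemma seq_morphismD:
  assumes "seq_morphism T n \<alpha> \<beta> \<phi>" "n \<ge> 3"
  shows "n_sequence T n \<alpha>" "n_sequence T n \<beta>" "length \<phi> = n"
    "k < n \<Longrightarrow> \<phi> ! k \<in> Hom T (src T (\<alpha> ! k)) (src T (\<beta> ! k))"
    "Suc k < n \<Longrightarrow> \<phi> ! Suc k \<cdot> \<alpha> ! k = \<beta> ! k \<cdot> \<phi> ! k"
    "susp T (\<phi> ! 0) \<cdot> \<alpha> ! (n - 1) = \<beta> ! (n - 1) \<cdot> \<phi> ! (n - 1)"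
    "hd \<phi> = \<phi> ! 0" "last \<phi> = \<phi> ! (n - 1)"
proof -
  show a: "n_sequence T n \<alpha>" and b: "n_sequence T n \<beta>" and l: "length \<phi> = n"
    using assms(1) by (auto simp: seq_morphism_def)
  show "k < n \<Longrightarrow> \<phi> ! k \<in> Hom T (src T (\<alpha> ! k)) (src T (\<beta> ! k))"
    "Suc k < n \<Longrightarrow> \<phi> ! Suc k \<cdot> \<alpha> ! k = \<beta> ! k \<cdot> \<phi> ! k"
    using assms(1) by (auto simp: seq_morphism_def)
  show h: "hd \<phi> = \<phi> ! 0" using l assms(2) by (metis hd_conv_nth list.size(3) not_numeral_le_zero)
  show t: "last \<phi> = \<phi> ! (n - 1)" using l assms(2) by (metis last_conv_nth list.size(3) not_numeral_le_zero)
  show "susp T (\<phi> ! 0) \<cdot> \<alpha> ! (n - 1) = \<beta> ! (n - 1) \<cdot> \<phi> ! (n - 1)"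
    using assms(1) h t n_sequenceD(7)[OF a assms(2)] n_sequenceD(7)[OF b assms(2)]
    by (simp add: seq_morphism_def)
qed

text \<open>The last component of \<phi> runs between suspended objects, so it desuspends to some
  \<open>f\<close>, which becomes the first component; the others move up by one place. Only the
  square at the rotated end needs work: its sign occurs in both rows and cancels, and faithfulness
  of the suspension removes the rest.\<close>

lemma seq_morphism_left_rotationD:
  assumes n: "n \<ge> 3" and a: "n_sequence T n \<alpha>" and b: "n_sequence T n \<beta>"
    and m: "seq_morphism T n (left_rotation T n \<alpha>) (left_rotation T n \<beta>) \<phi>"
  obtains f where "susp T f = \<phi> ! (n - 1)" "seq_morphism T n \<alpha> \<beta> (f # butlast \<phi>)"
proof -
  note A = n_sequenceD[OF a n] and B = n_sequenceD[OF b n]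
  note RA = left_rotation_nth[OF a n] and RB = left_rotation_nth[OF b n]
  note M = seq_morphismD[OF m n]
  have a0: "\<alpha> ! 0 \<in> Hom T (src T (\<alpha> ! 0)) (src T (\<alpha> ! 1))" and b0: "\<beta> ! 0 \<in> Hom T (src T (\<beta> ! 0)) (src T (\<beta> ! 1))" using A(4)[of 0] B(4)[of 0] n by auto
  note sa0 = susp_Hom[OF a0] and sb0 = susp_Hom[OF b0]
  have "\<phi> ! (n - 1) \<in> Hom T (susp_obj T (src T (\<alpha> ! 0))) (susp_obj T (src T (\<beta> ! 0)))"
    using M(4)[of "n - 1"] n RA(3) RB(3) HomD[OF neg_Hom[OF sa0]] HomD[OF neg_Hom[OF sb0]] HomD[OF sa0] HomD[OF sb0]
    by (simp split: if_splits)
  from susp_surj[OF this HomD(4)[OF a0] HomD(4)[OF b0]]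
  obtain f where f: "f \<in> Hom T (src T (\<alpha> ! 0)) (src T (\<beta> ! 0))" "susp T f = \<phi> ! (n - 1)"
    by blast
  have p0: "\<phi> ! 0 \<in> Hom T (src T (\<alpha> ! 1)) (src T (\<beta> ! 1))"
    using M(4)[of 0] RA(2)[of 0] RB(2)[of 0] n by simp
  have "susp T (\<phi> ! 0) \<cdot> susp T (\<alpha> ! 0) = susp T (\<beta> ! 0) \<cdot> susp T f"
  proof (cases "even n")
    case True
    then show ?thesis using M(6) RA(3) RB(3) f(2) by simp
  next
    \<comment> \<open>For odd \<open>n\<close> both sides carry the rotation sign; bilinearity pulls
      it out, and a second negation removes it.\<close>
    case False
    then have "neg_arr T (susp T (\<phi> ! 0) \<cdot> susp T (\<alpha> ! 0)) = neg_arr T (susp T (\<beta> ! 0) \<cdot> susp T f)"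
      using M(6) RA(3) RB(3) f(2) comp_neg[OF sa0 susp_Hom[OF p0]] neg_comp[OF susp_Hom[OF f(1)] sb0] by simp
    then show ?thesis using neg_neg[OF comp_Hom[OF sa0 susp_Hom[OF p0]]] neg_neg[OF comp_Hom[OF susp_Hom[OF f(1)] sb0]] by metis
  qed
  then have "susp T (\<phi> ! 0 \<cdot> \<alpha> ! 0) = susp T (\<beta> ! 0 \<cdot> f)"
    using susp_comp[OF a0 p0] susp_comp[OF f(1) b0] by simp
  then have sq0: "\<phi> ! 0 \<cdot> \<alpha> ! 0 = \<beta> ! 0 \<cdot> f"
    using susp_inj HomD(1)[OF comp_Hom[OF a0 p0]] HomD(1)[OF comp_Hom[OF f(1) b0]] by blast
  have nth: "(f # butlast \<phi>) ! k = (if k = 0 then f else \<phi> ! (k - 1))" if "k < n" for k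
    using that M(3) by (cases k) (auto simp: nth_butlast)
  have "seq_morphism T n \<alpha> \<beta> (f # butlast \<phi>)"
    unfolding seq_morphism_def
  proof (intro conjI allI impI)
    show "n_sequence T n \<alpha>" "n_sequence T n \<beta>" by fact+
    show "length (f # butlast \<phi>) = n" using M(3) n by simp
    fix k
    show "(f # butlast \<phi>) ! k \<in> Hom T (src T (\<alpha> ! k)) (src T (\<beta> ! k))" if "k < n"
      using nth[OF that] f(1) M(4)[of "k - 1"] RA(2)[of "k - 1"] RB(2)[of "k - 1"] that by auto
    show "(f # butlast \<phi>) ! Suc k \<cdot> \<alpha> ! k = \<beta> ! k \<cdot> (f # butlast \<phi>) ! k" if "Suc k < n"
      using nth[of k] nth[of "Suc k"] sq0 M(5)[of "k - 1"] RA(2)[of "k - 1"] RB(2)[of "k - 1"] that by auto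
    \<comment> \<open>The wrap-around square of the original sequences is the ordinary square at
      index \<open>n - 2\<close> of the rotated ones.\<close>
    have "last (f # butlast \<phi>) = \<phi> ! (n - 2)"
      using nth[of "n - 1"] M(3) n last_conv_nth[of "f # butlast \<phi>"] by (simp add: numeral_2_eq_2)
    moreover have "Suc (n - 2) = n - 1" using n by simp
    ultimately show "susp T (hd (f # butlast \<phi>)) \<cdot> last \<alpha> = last \<beta> \<cdot> last (f # butlast \<phi>)"
      using f(2) M(5)[of "n - 2"] A(7) B(7) RA(2)[of "n - 2"] RB(2)[of "n - 2"] n by simp
  qed
  then show ?thesis using that f(2) by blast
qed

end

section \<open>Fill-ins, vanishing composites and completions at arbitrary positions\<close>

context n_angulated_category
begin

lemmas angleD = n_sequenceD[OF angles_sequence n_ge_3]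
lemmas rotation_nth = left_rotation_nth[OF angles_sequence n_ge_3]
lemmas morphismD = seq_morphismD[OF _ n_ge_3]

lemma rotate_angle: "\<alpha> \<in> angles T \<Longrightarrow> (left_rotation T n ^^ k) \<alpha> \<in> angles T"
  by (induction k) (use F2 angles_sequence in auto)

lemma rotate_nth:
  assumes "\<alpha> \<in> angles T"
  shows "i + k < n \<Longrightarrow> (left_rotation T n ^^ k) \<alpha> ! i = \<alpha> ! (i + k)"
proof (induction k arbitrary: i)
  case (Suc k)
  then show ?case using rotation_nth(2)[OF rotate_angle[OF assms], of i k] by simp
qed simp

lemma rotate_nth_susp:
  assumes "\<alpha> \<in> angles T"
  shows "(left_rotation T n ^^ (n - 1)) \<alpha> ! 1
     = (if even n then susp T (\<alpha> ! 0) else neg_arr T (susp T (\<alpha> ! 0)))"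
proof -
  \<comment> \<open>The first rotation places the suspended morphism, with its sign, at index
    \<open>n - 1\<close>; each further one only moves it one place to the left. The case
    \<open>k = n - 2\<close> reaches index 1.\<close>
  have *: "(left_rotation T n ^^ (Suc k)) \<alpha> ! (n - 1 - k) = (if even n then susp T (\<alpha> ! 0) else neg_arr T (susp T (\<alpha> ! 0)))"
    if "k \<le> n - 2" for k
    using that
  proof (induction k)
    case 0
    then show ?case using rotation_nth(3)[OF assms] by simp
  next
    case (Suc k)
    then have "Suc (n - 1 - Suc k) = n - 1 - k" "Suc (n - 1 - Suc k) < n" by auto
    then show ?case using Suc rotation_nth(2)[OF rotate_angle[OF assms], of "n - 1 - Suc k" "Suc k"] by simp
  qed
  have "Suc (n - 2) = n - 1" "n - 1 - (n - 2) = 1" using n_ge_3 by auto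
  then show ?thesis using *[of "n - 2"] by simp
qed

text \<open>Each rotation undone desuspends one component. Those that never wrapped around are
  recovered exactly, the first \<open>k\<close> through their suspensions, which is enough by
  faithfulness. The bound \<open>k \<le> n\<close> keeps to one full turn, beyond which some
  components would be suspended twice.\<close>

lemma rotate_morphismD:
  assumes "\<alpha> \<in> angles T" "\<beta> \<in> angles T"
    and "seq_morphism T n ((left_rotation T n ^^ k) \<alpha>) ((left_rotation T n ^^ k) \<beta>) \<phi>"
  shows "\<exists>\<psi>. seq_morphism T n \<alpha> \<beta> \<psi> \<and> (\<forall>i. i + k < n \<longrightarrow> \<psi> ! (i + k) = \<phi> ! i) \<and>
     (\<forall>i<k. k \<le> n \<longrightarrow> susp T (\<psi> ! i) = \<phi> ! (i + n - k))"
  using assms(3)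
proof (induction k arbitrary: \<phi>)
  case 0
  then show ?case by auto
next
  case (Suc k)
  let ?a = "(left_rotation T n ^^ k) \<alpha>" and ?b = "(left_rotation T n ^^ k) \<beta>"
  have "seq_morphism T n (left_rotation T n ?a) (left_rotation T n ?b) \<phi>" using Suc.prems by simp
  then obtain f where f: "susp T f = \<phi> ! (n - 1)" "seq_morphism T n ?a ?b (f # butlast \<phi>)"
    using seq_morphism_left_rotationD[OF n_ge_3] angles_sequence rotate_angle assms(1,2) by metis
  have l: "length \<phi> = n" using Suc.prems by (simp add: seq_morphism_def)
  obtain \<psi> where \<psi>: "seq_morphism T n \<alpha> \<beta> \<psi>" "\<And>i. i + k < n \<Longrightarrow> \<psi> ! (i + k) = (f # butlast \<phi>) ! i"
     "\<And>i. i<k \<Longrightarrow> k \<le> n \<Longrightarrow> susp T (\<psi> ! i) = (f # butlast \<phi>) ! (i + n - k)"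
    using Suc.IH[OF f(2)] by blast
  have 1: "\<psi> ! (i + Suc k) = \<phi> ! i" if "i + Suc k < n" for i
    using \<psi>(2)[of "Suc i"] that l by (simp add: nth_butlast)
  have 2: "susp T (\<psi> ! i) = \<phi> ! (i + n - Suc k)" if "i < Suc k" "Suc k \<le> n" for i
  proof (cases "i = k")
    case True
    then show ?thesis using \<psi>(2)[of 0] f(1) that by simp
  next
    case False
    then have "i < k" "k \<le> n" "i + n - k = Suc (i + n - Suc k)" "i + n - Suc k < n - 1"
      using that by auto
    then show ?thesis using \<psi>(3)[of i] l by (simp add: nth_butlast)
  qed
  show ?case using \<psi>(1) 1 2 by blast
qed

text \<open>After \<open>k\<close> rotations the given square is the first one, so (F3) applies.
  With \<open>Suc k < n\<close> neither of its morphisms has wrapped around, hence no sign or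
  suspension enters.\<close>

lemma F3_at:
  assumes "\<alpha> \<in> angles T" "\<beta> \<in> angles T" "Suc k < n"
    and "f \<in> Hom T (src T (\<alpha> ! k)) (src T (\<beta> ! k))"
    and "g \<in> Hom T (src T (\<alpha> ! Suc k)) (src T (\<beta> ! Suc k))"
    and "g \<cdot> \<alpha> ! k = \<beta> ! k \<cdot> f"
  obtains \<phi> where "seq_morphism T n \<alpha> \<beta> \<phi>" "\<phi> ! k = f" "\<phi> ! Suc k = g"
proof -
  let ?a = "(left_rotation T n ^^ k) \<alpha>" and ?b = "(left_rotation T n ^^ k) \<beta>"
  have nth: "?a ! 0 = \<alpha> ! k" "?a ! 1 = \<alpha> ! Suc k" "?b ! 0 = \<beta> ! k" "?b ! 1 = \<beta> ! Suc k"
    using rotate_nth[OF assms(1), of 0 k] rotate_nth[OF assms(1), of 1 k]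
      rotate_nth[OF assms(2), of 0 k] rotate_nth[OF assms(2), of 1 k] assms(3) by auto
  obtain \<psi> where \<psi>: "seq_morphism T n ?a ?b \<psi>" "\<psi> ! 0 = f" "\<psi> ! 1 = g"
    using F3[OF rotate_angle[OF assms(1)] rotate_angle[OF assms(2)], of f k k g] assms nth by auto
  obtain \<phi> where "seq_morphism T n \<alpha> \<beta> \<phi>" "\<And>i. i + k < n \<Longrightarrow> \<phi> ! (i + k) = \<psi> ! i"
    using rotate_morphismD[OF assms(1,2) \<psi>(1)] by blast
  then show ?thesis using that[of \<phi>] \<psi>(2,3) assms(3) by (metis Suc_lessD add_0 plus_1_eq_Suc)
qed

text \<open>After \<open>n - 1\<close> rotations the first morphism is the old last one, and the
  second object is the suspension of the old first object. The outer square thus becomes an instance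
  of (F3), with \<open>g\<close> and \<open>susp T f\<close> as the prescribed components.\<close>

lemma F3_last:
  assumes "\<alpha> \<in> angles T" "\<beta> \<in> angles T"
    and f: "f \<in> Hom T (src T (\<alpha> ! 0)) (src T (\<beta> ! 0))"
    and g: "g \<in> Hom T (src T (\<alpha> ! (n - 1))) (src T (\<beta> ! (n - 1)))"
    and "susp T f \<cdot> \<alpha> ! (n - 1) = \<beta> ! (n - 1) \<cdot> g"
  obtains \<phi> where "seq_morphism T n \<alpha> \<beta> \<phi>" "\<phi> ! 0 = f" "\<phi> ! (n - 1) = g"
proof -
  let ?a = "(left_rotation T n ^^ (n - 1)) \<alpha>" and ?b = "(left_rotation T n ^^ (n - 1)) \<beta>"
  have nth: "?a ! 0 = \<alpha> ! (n - 1)" "?b ! 0 = \<beta> ! (n - 1)"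
    using rotate_nth[OF assms(1), of 0 "n - 1"] rotate_nth[OF assms(2), of 0 "n - 1"] n_ge_3 by auto
  have s: "src T ((left_rotation T n ^^ (n - 1)) \<gamma> ! 1) = susp_obj T (src T (\<gamma> ! 0))"
    if "\<gamma> \<in> angles T" for \<gamma>
    using rotate_nth_susp[OF that] angleD(4)[OF that, of 0] n_ge_3 HomD(2)[OF susp_Hom] HomD(2)[OF neg_Hom[OF susp_Hom]]
    by (auto split: if_splits)
  have "susp T f \<in> Hom T (src T (?a ! 1)) (src T (?b ! 1))"
    using susp_Hom[OF f] s assms(1,2) by simp
  then obtain \<psi> where \<psi>: "seq_morphism T n ?a ?b \<psi>" "\<psi> ! 0 = g" "\<psi> ! 1 = susp T f"
    using F3[OF rotate_angle[OF assms(1)] rotate_angle[OF assms(2)], of g "n - 1" "n - 1" "susp T f"] assms nth by auto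
  obtain \<phi> where \<phi>: "seq_morphism T n \<alpha> \<beta> \<phi>" "\<And>i. i + (n - 1) < n \<Longrightarrow> \<phi> ! (i + (n - 1)) = \<psi> ! i"
     "\<And>i. i < n - 1 \<Longrightarrow> n - 1 \<le> n \<Longrightarrow> susp T (\<phi> ! i) = \<psi> ! (i + n - (n - 1))"
    using rotate_morphismD[OF assms(1,2) \<psi>(1)] by blast
  have "susp T (\<phi> ! 0) = susp T f" using \<phi>(3)[of 0] \<psi>(3) n_ge_3 by simp
  then have "\<phi> ! 0 = f" using susp_inj HomD(1)[OF f] HomD(1)[OF morphismD(4)[OF \<phi>(1), of 0]] n_ge_3 by auto
  moreover have "\<phi> ! (n - 1) = g" using \<phi>(2)[of 0] \<psi>(2) n_ge_3 by simp
  ultimately show ?thesis using that \<phi>(1) by blast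
qed

text \<open>The identity and \<alpha>'s first morphism start a morphism from the trivial n-angle to
  \<alpha>. Its next square factors the composite through a zero object.\<close>

lemma comp_first_eq_zero:
  assumes a: "\<alpha> \<in> angles T"
  shows "\<alpha> ! 1 \<cdot> \<alpha> ! 0 = zero_arr T (src T (\<alpha> ! 0)) (tgt T (\<alpha> ! 1))"
proof -
  obtain Z where Z: "zero_object T Z" using ex_zero_object by blast
  then have Zo: "Z \<in> obj T" by (simp add: zero_object_def)
  let ?X = "src T (\<alpha> ! 0)" and ?Y = "src T (\<alpha> ! 1)"
  have a0: "\<alpha> ! 0 \<in> Hom T ?X ?Y" using angleD(4)[OF a, of 0] n_ge_3 by simp
  note X = HomD(4)[OF a0]
  let ?t = "trivial_sequence T n ?X Z"
  have t: "?t \<in> angles T" using F1_trivial X Z by blast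
  have t0: "?t ! 0 = idn T ?X" and t1: "?t ! 1 = zero_arr T ?X Z" by (auto simp: trivial_sequence_def)
  have id: "idn T ?X \<in> Hom T ?X ?X" using idn_Hom X by blast
  obtain \<phi> where \<phi>: "seq_morphism T n ?t \<alpha> \<phi>" "\<phi> ! 0 = idn T ?X" "\<phi> ! 1 = \<alpha> ! 0"
    using F3[OF t a, of "idn T ?X" "\<alpha> ! 0"] id a0 t0 t1 HomD(2)[OF id] HomD(2)[OF zero_Hom[OF X Zo]]
      by auto
  have "?t ! 1 \<in> Hom T (src T (?t ! 1)) (src T (?t ! 2))" "\<alpha> ! 1 \<in> Hom T (src T (\<alpha> ! 1)) (src T (\<alpha> ! 2))"
    using angleD(4)[OF t, of 1] angleD(4)[OF a, of 1] n_ge_3 by (simp_all add: numeral_2_eq_2)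
  from HomD(3)[OF this(1)] HomD(3)[OF this(2)]
  have "src T (?t ! 2) = Z" "tgt T (\<alpha> ! 1) = src T (\<alpha> ! 2)"
    using t1 HomD(3)[OF zero_Hom[OF X Zo]] by simp_all
  then have "\<phi> ! 2 \<in> Hom T Z (tgt T (\<alpha> ! 1))" using morphismD(4)[OF \<phi>(1), of 2] n_ge_3 by simp
  moreover have "\<alpha> ! 1 \<cdot> \<alpha> ! 0 = \<phi> ! 2 \<cdot> zero_arr T ?X Z"
    using morphismD(5)[OF \<phi>(1), of 1] n_ge_3 \<phi>(3) t1 by (simp add: numeral_2_eq_2)
  ultimately show ?thesis using comp_zero X by metis
qed

lemma comp_eq_zero:
  assumes a: "\<alpha> \<in> angles T" and k: "Suc k < n"
  shows "\<alpha> ! Suc k \<cdot> \<alpha> ! k = zero_arr T (src T (\<alpha> ! k)) (tgt T (\<alpha> ! Suc k))"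
  using comp_first_eq_zero[OF rotate_angle[OF a], of k] rotate_nth[OF a, of 0 k] rotate_nth[OF a, of 1 k] k by simp

text \<open>These two morphisms are, up to sign, the first two of the n-angle rotated
  \<open>n - 1\<close> times. This vanishing is what later makes the suspended inflation annihilate
  its phantom.\<close>

lemma susp_comp_last_eq_zero:
  assumes a: "\<alpha> \<in> angles T"
  shows "susp T (\<alpha> ! 0) \<cdot> \<alpha> ! (n - 1) =
    zero_arr T (src T (\<alpha> ! (n - 1))) (susp_obj T (tgt T (\<alpha> ! 0)))"
proof -
  let ?g = "susp T (\<alpha> ! 0)" and ?X = "src T (\<alpha> ! (n - 1))" and ?S = "susp_obj T (tgt T (\<alpha> ! 0))"
  have g: "?g \<in> Hom T (susp_obj T (src T (\<alpha> ! 0))) ?S"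
    using susp_Hom[OF arr_Hom[OF angleD(2)[OF a, of 0]]] n_ge_3 by simp
  have f: "\<alpha> ! (n - 1) \<in> Hom T ?X (susp_obj T (src T (\<alpha> ! 0)))" using angleD(5)[OF a] .
  note z = comp_first_eq_zero[OF rotate_angle[OF a], of "n - 1"]
  have r0: "(left_rotation T n ^^ (n - 1)) \<alpha> ! 0 = \<alpha> ! (n - 1)" using rotate_nth[OF a, of 0 "n - 1"] n_ge_3 by simp
  show ?thesis
  proof (cases "even n")
    case True
    then show ?thesis using z rotate_nth_susp[OF a] r0 HomD(3)[OF g] by simp
  next
    case False
    then have "neg_arr T (?g \<cdot> \<alpha> ! (n - 1)) = zero_arr T ?X ?S"
      using z rotate_nth_susp[OF a] r0 HomD(3)[OF neg_Hom[OF g]] neg_comp[OF f g] by simp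
    then show ?thesis using neg_neg[OF comp_Hom[OF f g]] neg_zero HomD(4)[OF f] HomD(5)[OF g] by simp
  qed
qed

text \<open>Left rotation is inverted by desuspending the last morphism. The conclusion leaves out
  the new first morphism, the only one that carries a sign.\<close>

lemma ex_right_rotation:
  assumes c: "\<gamma> \<in> angles T"
  obtains \<alpha> where "\<alpha> \<in> angles T" "tl \<alpha> = butlast \<gamma>"
proof -
  let ?X = "src T (\<gamma> ! (n - 1))" and ?Y = "src T (\<gamma> ! 0)"
  note C = angleD[OF c]
  \<comment> \<open>The sign is inserted in advance so that left rotation, which multiplies by
    (-1)^n again, returns \<gamma> exactly.\<close>
  let ?h = "if even n then \<gamma> ! (n - 1) else neg_arr T (\<gamma> ! (n - 1))"
  have h: "?h \<in> Hom T ?X (susp_obj T ?Y)" using C(5) neg_Hom by simp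
  obtain W where W: "W \<in> obj T" "susp_obj T W = ?X"
    using susp_obj_bij C(3)[of "n - 1"] n_ge_3 unfolding bij_betw_def by (metis diff_less image_iff less_le_trans zero_less_numeral zero_less_one)
  obtain x where x: "x \<in> Hom T W ?Y" "susp T x = ?h"
    using susp_surj[of ?h W ?Y] h W C(3)[of 0] n_ge_3 by auto
  let ?a = "x # butlast \<gamma>"
  have nth: "?a ! k = (if k = 0 then x else \<gamma> ! (k - 1))" if "k < n" for k
    using that C(1) by (cases k) (auto simp: nth_butlast)
  have "n_sequence T n ?a"
  proof (rule n_sequenceI[OF n_ge_3])
    show "length ?a = n" using C(1) n_ge_3 by simp
    show "?a ! k \<in> Hom T (src T (?a ! k)) (src T (?a ! Suc k))" if "Suc k < n" for k
      using nth[of k] nth[of "Suc k"] that x(1) HomD(2)[OF x(1)] C(4)[of "k - 1"] by (auto simp del: nth_Cons_Suc)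
    have "Suc (n - 2) = n - 1" "n - 1 \<noteq> 0" "n - 1 - 1 = n - 2" using n_ge_3 by auto
    then show "?a ! (n - 1) \<in> Hom T (src T (?a ! (n - 1))) (susp_obj T (src T (?a ! 0)))"
      using nth[of "n - 1"] HomD(2)[OF x(1)] W(2) C(4)[of "n - 2"] n_ge_3 by simp
  qed
  moreover have "left_rotation T n ?a = \<gamma>"
  proof -
    have "\<gamma> \<noteq> []" using C(1) n_ge_3 by auto
    then show ?thesis
      using x(2) neg_neg[OF C(5)] C(7) append_butlast_last_id[of \<gamma>] by (simp add: left_rotation_def)
  qed
  ultimately have "?a \<in> angles T" using F2 c by simp
  then show ?thesis using that by force
qed

text \<open>(F1) completes \<open>f\<close> only to an n-angle that begins with it;
  \<open>n - 1\<close> right rotations carry \<open>f\<close> to the last position.\<close>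

lemma ex_angle_last:
  assumes f: "f \<in> Hom T W (susp_obj T X)" and X: "X \<in> obj T"
  obtains \<alpha> where "\<alpha> \<in> angles T" "last \<alpha> = f" "src T (\<alpha> ! 0) = X"
proof -
  obtain \<gamma> where c: "\<gamma> \<in> angles T" "hd \<gamma> = f" using F1_complete HomD(1)[OF f] by blast
  \<comment> \<open>The invariant records only entries that have not wrapped around, so no signs
    appear in it. At \<open>k = n - 1\<close> exactly one entry is left, namely
    \<open>f\<close>.\<close>
  have "k < n \<Longrightarrow> \<exists>\<alpha> \<in> angles T. drop k \<alpha> = take (n - k) \<gamma>" for k
  proof (induction k)
    case 0
    then show ?case using c angleD(1)[OF c(1)] by auto
  next
    case (Suc k)
    then obtain \<alpha> where a: "\<alpha> \<in> angles T" "drop k \<alpha> = take (n - k) \<gamma>" by auto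
    obtain \<beta> where b: "\<beta> \<in> angles T" "tl \<beta> = butlast \<alpha>" using ex_right_rotation a(1) by blast
    have "drop (Suc k) \<beta> = drop k (butlast \<alpha>)" using b(2) by (simp add: drop_Suc)
    also have "\<dots> = butlast (take (n - k) \<gamma>)" using a(2) by (simp add: drop_butlast)
    also have "\<dots> = take (n - Suc k) \<gamma>" using angleD(1)[OF c(1)] Suc.prems by (simp add: butlast_take)
    finally show ?case using b(1) by blast
  qed
  from this[of "n - 1"] obtain \<alpha> where a: "\<alpha> \<in> angles T" "drop (n - 1) \<alpha> = take 1 \<gamma>"
    using n_ge_3 by auto
  have "\<alpha> ! (n - 1) = \<gamma> ! 0"
    using a angleD(1)[OF a(1)] angleD(1)[OF c(1)] n_ge_3 nth_drop[of "n - 1" \<alpha> 0] by simp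
  then have l: "last \<alpha> = f" "\<alpha> ! (n - 1) = f" using angleD(7)[OF a(1)] angleD(6)[OF c(1)] c(2) by auto
  then have "susp_obj T (src T (\<alpha> ! 0)) = susp_obj T X" using angleD(5)[OF a(1)] HomD(3)[OF f] HomD(3) by metis
  then have "src T (\<alpha> ! 0) = X" using susp_obj_inj angleD(3)[OF a(1), of 0] X n_ge_3 by auto
  then show ?thesis using that a(1) l by blast
qed

end

section \<open>Base change, cobase change and stability of phantoms\<close>

locale almost_n_exact_category =
  n_angulated_category T n + almost_n_exact_structure T n A E
  for T :: "('o, 'm, 'z) angulated_category_scheme" (structure)
    and n :: nat and A :: "'o set" and E :: "'m list set" +
  assumes A_obj: "A \<subseteq> obj T"
begin

lemma E_D:
  assumes "\<alpha> \<in> E"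
  shows "\<alpha> \<in> angles T" "k < n \<Longrightarrow> src T (\<alpha> ! k) \<in> A"
  using assms E_angles angleD(1)[of \<alpha>] by (auto simp: angles_in_def)

text \<open>(N2) transfers membership in \<open>E\<close> but produces no n-angle. The candidate
  comes from completing the composite as a last morphism, and \<open>F3_last\<close> with the
  identity and \<open>f\<close> supplies the morphism to \<alpha> that (N2) demands.\<close>

lemma ex_base_change:
  assumes a: "\<alpha> \<in> E" and f: "f \<in> arr_in T A" "tgt T f = src T (\<alpha> ! (n - 1))"
  obtains \<beta> where "\<beta> \<in> E" "src T (\<beta> ! 0) = src T (\<alpha> ! 0)" "src T (\<beta> ! (n - 1)) = src T f"
    "\<beta> ! (n - 1) = \<alpha> ! (n - 1) \<cdot> f"
proof -
  note aa = E_D(1)[OF a]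
  let ?X = "src T (\<alpha> ! 0)" and ?N = "src T (\<alpha> ! (n - 1))"
  have fH: "f \<in> Hom T (src T f) ?N" using f by (simp add: arr_in_def Hom_def)
  have X: "?X \<in> obj T" using angleD(3)[OF aa, of 0] n_ge_3 by simp
  have c: "\<alpha> ! (n - 1) \<cdot> f \<in> Hom T (src T f) (susp_obj T ?X)" using comp_Hom[OF fH angleD(5)[OF aa]] .
  obtain \<beta> where b: "\<beta> \<in> angles T" "last \<beta> = \<alpha> ! (n - 1) \<cdot> f" "src T (\<beta> ! 0) = ?X"
    using ex_angle_last[OF c X] by blast
  note l = angleD(7)[OF b(1)]
  have s: "src T (\<beta> ! (n - 1)) = src T f" using l b(2) HomD(2)[OF c] by simp
  have "susp T (idn T ?X) \<cdot> \<beta> ! (n - 1) = \<alpha> ! (n - 1) \<cdot> f"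
    using l b(2) susp_idn[OF X] idn_left[OF c] by simp
  then obtain \<phi> where \<phi>: "seq_morphism T n \<beta> \<alpha> \<phi>" "\<phi> ! 0 = idn T ?X" "\<phi> ! (n - 1) = f"
    using F3_last[OF b(1) aa, of "idn T ?X" f] b(3) idn_Hom[OF X] s fH by auto
  have "\<beta> \<in> E"
    using N2[OF a f(1) _ b(1) _ \<phi>(1)] f(2) b(2) \<phi>(2,3) angleD(6,7)[OF aa] morphismD(7,8)[OF \<phi>(1)] by simp
  then show ?thesis using that b s l by simp
qed

text \<open>The dual construction for (N3): the morphism of n-angles now leaves \<alpha>, with
  \<open>g\<close> first and the identity last.\<close>

lemma ex_cobase_change:
  assumes a: "\<alpha> \<in> E" and g: "g \<in> arr_in T A" "src T g = src T (\<alpha> ! 0)"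
  obtains \<beta> where "\<beta> \<in> E" "src T (\<beta> ! 0) = tgt T g" "src T (\<beta> ! (n - 1)) = src T (\<alpha> ! (n - 1))"
    "\<beta> ! (n - 1) = susp T g \<cdot> \<alpha> ! (n - 1)"
proof -
  note aa = E_D(1)[OF a]
  let ?X = "src T (\<alpha> ! 0)" and ?N = "src T (\<alpha> ! (n - 1))"
  have gH: "g \<in> Hom T ?X (tgt T g)" using g by (simp add: arr_in_def Hom_def)
  have N: "?N \<in> obj T" using angleD(3)[OF aa, of "n - 1"] n_ge_3 by simp
  have c: "susp T g \<cdot> \<alpha> ! (n - 1) \<in> Hom T ?N (susp_obj T (tgt T g))"
    using comp_Hom[OF angleD(5)[OF aa] susp_Hom[OF gH]] .
  obtain \<beta> where b: "\<beta> \<in> angles T" "last \<beta> = susp T g \<cdot> \<alpha> ! (n - 1)" "src T (\<beta> ! 0) = tgt T g"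
    using ex_angle_last[OF c HomD(5)[OF gH]] by blast
  note l = angleD(7)[OF b(1)]
  have s: "src T (\<beta> ! (n - 1)) = ?N" using l b(2) HomD(2)[OF c] by simp
  have "susp T g \<cdot> \<alpha> ! (n - 1) = \<beta> ! (n - 1) \<cdot> idn T ?N"
    using l b(2) idn_right[OF c] by simp
  then obtain \<phi> where \<phi>: "seq_morphism T n \<alpha> \<beta> \<phi>" "\<phi> ! 0 = g" "\<phi> ! (n - 1) = idn T ?N"
    using F3_last[OF aa b(1), of g "idn T ?N"] b(3) idn_Hom[OF N] s gH by auto
  have "\<beta> \<in> E"
    using N3[OF a g(1) _ b(1) _ \<phi>(1)] g(2) b(2) \<phi>(2,3) angleD(6,7)[OF aa] morphismD(7,8)[OF \<phi>(1)] by simp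
  then show ?thesis using that b s l by simp
qed

lemma phantomE:
  assumes "\<phi> \<in> phantoms E"
  obtains \<alpha> where "\<alpha> \<in> E" "\<phi> = \<alpha> ! (n - 1)" "\<phi> \<in> Hom T (src T \<phi>) (susp_obj T (src T (\<alpha> ! 0)))"
  using assms E_D(1) angleD(5,7) by (fastforce simp: phantoms_def)

lemma phantomI: "\<alpha> \<in> E \<Longrightarrow> \<alpha> ! (n - 1) \<in> phantoms E"
  using E_D(1) angleD(7) unfolding phantoms_def by (metis imageI)

lemma phantom_comp:
  assumes "\<phi> \<in> phantoms E" "f \<in> arr_in T A" "tgt T f = src T \<phi>"
  shows "\<phi> \<cdot> f \<in> phantoms E"
proof -
  obtain \<alpha> where a: "\<alpha> \<in> E" "\<phi> = \<alpha> ! (n - 1)" using phantomE assms(1) by metis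
  obtain \<beta> where "\<beta> \<in> E" "\<beta> ! (n - 1) = \<phi> \<cdot> f" using ex_base_change[OF a(1) assms(2)] assms(3) a(2) by metis
  then show ?thesis using phantomI by metis
qed

lemma susp_comp_phantom:
  assumes "\<phi> \<in> phantoms E" "g \<in> arr_in T A" "tgt T \<phi> = susp_obj T (src T g)"
  shows "susp T g \<cdot> \<phi> \<in> phantoms E"
proof -
  obtain \<alpha> where a: "\<alpha> \<in> E" "\<phi> = \<alpha> ! (n - 1)" "\<phi> \<in> Hom T (src T \<phi>) (susp_obj T (src T (\<alpha> ! 0)))"
    using phantomE assms(1) by metis
  have "src T g = src T (\<alpha> ! 0)"
    using susp_obj_inj[of "src T g" "src T (\<alpha> ! 0)"] HomD(3)[OF a(3)] assms(2,3) src_obj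
      angleD(3)[OF E_D(1)[OF a(1)], of 0] n_ge_3 by (auto simp: arr_in_def)
  then obtain \<beta> where "\<beta> \<in> E" "\<beta> ! (n - 1) = susp T g \<cdot> \<phi>"
    using ex_cobase_change[OF a(1) assms(2)] a(2) by metis
  then show ?thesis using phantomI by metis
qed

section \<open>Orthogonals are ideals\<close>

lemma arr_inI: "f \<in> Hom T X Y \<Longrightarrow> X \<in> A \<Longrightarrow> Y \<in> A \<Longrightarrow> f \<in> arr_in T A"
  by (auto simp: arr_in_def Hom_def)

lemma arr_inD: "f \<in> arr_in T A \<Longrightarrow> f \<in> Hom T (src T f) (tgt T f)"
  by (auto simp: arr_in_def Hom_def)


lemma phantom_Hom:
  assumes "\<phi> \<in> phantoms E" "src T \<phi> = X" "tgt T \<phi> = Y"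
  shows "\<phi> \<in> Hom T X Y"
  using assms HomD(1)[of \<phi>] phantomE[OF assms(1)] by (metis HomD(3))

text \<open>Sums, negatives and composition after a member follow from bilinearity and
  associativity. Composition before a member changes the object on which phantoms are tested, and
  there (N3) enters through \<open>susp_comp_phantom\<close>.\<close>

lemma right_perp_ideal:
  assumes M: "M \<subseteq> arr_in T A"
  shows "ideal_in T A (right_perp T A E M)"
  unfolding ideal_in_def
proof (intro conjI ballI impI)
  let ?P = "right_perp T A E M"
  show sub: "?P \<subseteq> arr_in T A" by (auto simp: right_perp_def)
  have perp: "susp T g \<cdot> \<phi> \<cdot> m = zero_arr T (src T m) (susp_obj T (tgt T g))"
    if "g \<in> ?P" "m \<in> M" "\<phi> \<in> phantoms E" "src T \<phi> = tgt T m" "tgt T \<phi> = susp_obj T (src T g)" for g m \<phi>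
    using that by (auto simp: right_perp_def orthogonal_def)
  \<comment> \<open>Orthogonality is restated with typed \<open>m\<close> and \<phi>, since the
    rules for composition are formulated for membership in \<open>Hom\<close>.\<close>
  have I: "g \<in> ?P" if "g \<in> Hom T X Y" "X \<in> A" "Y \<in> A"
      and "\<And>m \<phi>. m \<in> M \<Longrightarrow> \<phi> \<in> phantoms E \<Longrightarrow> m \<in> Hom T (src T m) (tgt T m) \<Longrightarrow>
        \<phi> \<in> Hom T (tgt T m) (susp_obj T X) \<Longrightarrow>
        susp T g \<cdot> \<phi> \<cdot> m = zero_arr T (src T m) (susp_obj T Y)" for g X Y
    using that arr_inI[OF that(1-3)] HomD(2,3)[OF that(1)] phantom_Hom M arr_inD
    by (auto simp: right_perp_def orthogonal_def)
  show "subgroup (?P \<inter> Hom T X Y) (hom_group T X Y)" if XY: "X \<in> A" "Y \<in> A" for X Y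
  proof (rule subgroup_HomI)
    show o: "X \<in> obj T" "Y \<in> obj T" using that A_obj by auto
    show "zero_arr T X Y \<in> ?P"
    proof (rule I[OF zero_Hom[OF o] XY])
      fix m \<phi> assume m: "m \<in> Hom T (src T m) (tgt T m)" and p: "\<phi> \<in> Hom T (tgt T m) (susp_obj T X)"
      show "susp T (zero_arr T X Y) \<cdot> \<phi> \<cdot> m = zero_arr T (src T m) (susp_obj T Y)"
        using susp_zero[OF o] zero_comp[OF p] zero_comp[OF m] susp_obj_in o by simp
    qed
    fix f assume f: "f \<in> ?P \<inter> Hom T X Y"
    show "neg_arr T f \<in> ?P"
    proof (rule I[OF neg_Hom XY])
      show "f \<in> Hom T X Y" using f by simp
      then have sf: "susp T f \<in> Hom T (susp_obj T X) (susp_obj T Y)" using susp_Hom by blast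
      fix m \<phi> assume h: "m \<in> M" "\<phi> \<in> phantoms E" and m: "m \<in> Hom T (src T m) (tgt T m)" and p: "\<phi> \<in> Hom T (tgt T m) (susp_obj T X)"
      have "susp T f \<cdot> \<phi> \<cdot> m = zero_arr T (src T m) (susp_obj T Y)"
        using perp[of f m \<phi>] f h HomD[OF p] by (auto simp: Hom_def)
      then show "susp T (neg_arr T f) \<cdot> \<phi> \<cdot> m = zero_arr T (src T m) (susp_obj T Y)"
        using f susp_neg[of f X Y] neg_comp[OF p sf] neg_comp[OF m comp_Hom[OF p sf]] neg_zero HomD(4)[OF m] HomD(5)[OF sf]
        by simp
    qed
    fix g assume g: "g \<in> ?P \<inter> Hom T X Y"
    show "add_arr T f g \<in> ?P"
    proof (rule I[OF add_Hom XY])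
      show fH: "f \<in> Hom T X Y" and gH: "g \<in> Hom T X Y" using f g by auto
      note sf = susp_Hom[OF fH] and sg = susp_Hom[OF gH]
      fix m \<phi> assume h: "m \<in> M" "\<phi> \<in> phantoms E" and m: "m \<in> Hom T (src T m) (tgt T m)" and p: "\<phi> \<in> Hom T (tgt T m) (susp_obj T X)"
      have "susp T f \<cdot> \<phi> \<cdot> m = zero_arr T (src T m) (susp_obj T Y)" "susp T g \<cdot> \<phi> \<cdot> m = zero_arr T (src T m) (susp_obj T Y)"
        using perp[of f m \<phi>] perp[of g m \<phi>] f g h HomD[OF p] by (auto simp: Hom_def)
      then show "susp T (add_arr T f g) \<cdot> \<phi> \<cdot> m = zero_arr T (src T m) (susp_obj T Y)"
        using susp_add[OF fH gH] comp_add_left[OF p sf sg] comp_add_left[OF m comp_Hom[OF p sf] comp_Hom[OF p sg]]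
          add_zero HomD(4)[OF m] HomD(5)[OF sf] by simp
    qed
  qed
  fix f h assume f: "f \<in> ?P" and h: "h \<in> arr_in T A"
  have fA: "f \<in> arr_in T A" using sub f by blast
  note fH = arr_inD[OF fA] and hH = arr_inD[OF h]
  show "h \<cdot> f \<in> ?P" if e: "src T h = tgt T f"
  proof (rule I)
    have hH': "h \<in> Hom T (tgt T f) (tgt T h)" using hH e by simp
    show "h \<cdot> f \<in> Hom T (src T f) (tgt T h)" using comp_Hom fH hH' .
    show "src T f \<in> A" "tgt T h \<in> A" using fA h by (auto simp: arr_in_def)
    fix m \<phi> assume mp: "m \<in> M" "\<phi> \<in> phantoms E" and m: "m \<in> Hom T (src T m) (tgt T m)" and p: "\<phi> \<in> Hom T (tgt T m) (susp_obj T (src T f))"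
    note sf = susp_Hom[OF fH] and sh = susp_Hom[OF hH']
    have "susp T (h \<cdot> f) \<cdot> \<phi> \<cdot> m = susp T h \<cdot> (susp T f \<cdot> \<phi> \<cdot> m)"
      using susp_comp[OF fH hH'] comp_assoc[OF p sf sh] comp_assoc[OF m comp_Hom[OF p sf] sh] by simp
    also have "\<dots> = zero_arr T (src T m) (susp_obj T (tgt T h))"
      using perp[OF f mp] HomD(2,3)[OF p] comp_zero[OF sh] HomD(4)[OF m] by simp
    finally show "susp T (h \<cdot> f) \<cdot> \<phi> \<cdot> m = zero_arr T (src T m) (susp_obj T (tgt T h))" .
  qed
  show "f \<cdot> h \<in> ?P" if e: "tgt T h = src T f"
  proof (rule I)
    have hH': "h \<in> Hom T (src T h) (src T f)" using hH e by simp
    show "f \<cdot> h \<in> Hom T (src T h) (tgt T f)" using comp_Hom hH' fH .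
    show "src T h \<in> A" "tgt T f \<in> A" using fA h by (auto simp: arr_in_def)
    fix m \<phi> assume mp: "m \<in> M" "\<phi> \<in> phantoms E" and m: "m \<in> Hom T (src T m) (tgt T m)" and p: "\<phi> \<in> Hom T (tgt T m) (susp_obj T (src T h))"
    note sf = susp_Hom[OF fH] and sh = susp_Hom[OF hH']
    \<comment> \<open>Absorbing \<open>h\<close> into the phantom gives a phantom against which
      \<open>f\<close> can be tested directly.\<close>
    have q: "susp T h \<cdot> \<phi> \<in> phantoms E" using susp_comp_phantom mp(2) h HomD(3)[OF p] by blast
    show "susp T (f \<cdot> h) \<cdot> \<phi> \<cdot> m = zero_arr T (src T m) (susp_obj T (tgt T f))"
      using susp_comp[OF hH' fH] comp_assoc[OF p sh sf] perp[OF f mp(1) q] HomD(2,3)[OF comp_Hom[OF p sh]] by simp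
  qed
qed

text \<open>Here composition before a member is formal, whereas composition after it changes the
  source of the phantoms and uses (N2) through \<open>phantom_comp\<close>.\<close>

lemma left_perp_ideal:
  assumes M: "M \<subseteq> arr_in T A"
  shows "ideal_in T A (left_perp T A E M)"
  unfolding ideal_in_def
proof (intro conjI ballI impI)
  let ?P = "left_perp T A E M"
  show sub: "?P \<subseteq> arr_in T A" by (auto simp: left_perp_def)
  have perp: "susp T m \<cdot> \<phi> \<cdot> g = zero_arr T (src T g) (susp_obj T (tgt T m))"
    if "g \<in> ?P" "m \<in> M" "\<phi> \<in> phantoms E" "src T \<phi> = tgt T g" "tgt T \<phi> = susp_obj T (src T m)" for g m \<phi>
    using that by (auto simp: left_perp_def orthogonal_def)
  have I: "g \<in> ?P" if "g \<in> Hom T X Y" "X \<in> A" "Y \<in> A"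
      and "\<And>m \<phi>. m \<in> M \<Longrightarrow> \<phi> \<in> phantoms E \<Longrightarrow>
        susp T m \<in> Hom T (susp_obj T (src T m)) (susp_obj T (tgt T m)) \<Longrightarrow>
        \<phi> \<in> Hom T Y (susp_obj T (src T m)) \<Longrightarrow>
        susp T m \<cdot> \<phi> \<cdot> g = zero_arr T X (susp_obj T (tgt T m))" for g X Y
    using that arr_inI[OF that(1-3)] HomD(2,3)[OF that(1)] phantom_Hom M susp_Hom[OF arr_inD]
    by (auto simp: left_perp_def orthogonal_def)
  show "subgroup (?P \<inter> Hom T X Y) (hom_group T X Y)" if XY: "X \<in> A" "Y \<in> A" for X Y
  proof (rule subgroup_HomI)
    show o: "X \<in> obj T" "Y \<in> obj T" using that A_obj by auto
    show "zero_arr T X Y \<in> ?P"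
    proof (rule I[OF zero_Hom[OF o] XY])
      fix m \<phi> assume m: "susp T m \<in> Hom T (susp_obj T (src T m)) (susp_obj T (tgt T m))"
        and p: "\<phi> \<in> Hom T Y (susp_obj T (src T m))"
      show "susp T m \<cdot> \<phi> \<cdot> zero_arr T X Y = zero_arr T X (susp_obj T (tgt T m))"
        using comp_zero[OF comp_Hom[OF p m]] o by simp
    qed
    fix f assume f: "f \<in> ?P \<inter> Hom T X Y"
    then have fH: "f \<in> Hom T X Y" by simp
    show "neg_arr T f \<in> ?P"
    proof (rule I[OF neg_Hom[OF fH] XY])
      fix m \<phi> assume h: "m \<in> M" "\<phi> \<in> phantoms E"
        and m: "susp T m \<in> Hom T (susp_obj T (src T m)) (susp_obj T (tgt T m))"
        and p: "\<phi> \<in> Hom T Y (susp_obj T (src T m))"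
      show "susp T m \<cdot> \<phi> \<cdot> neg_arr T f = zero_arr T X (susp_obj T (tgt T m))"
        using perp[of f m \<phi>] f h HomD[OF p] HomD[OF fH] comp_neg[OF fH comp_Hom[OF p m]]
          neg_zero HomD(5)[OF m] by simp
    qed
    fix g assume g: "g \<in> ?P \<inter> Hom T X Y"
    then have gH: "g \<in> Hom T X Y" by simp
    show "add_arr T f g \<in> ?P"
    proof (rule I[OF add_Hom[OF fH gH] XY])
      fix m \<phi> assume h: "m \<in> M" "\<phi> \<in> phantoms E"
        and m: "susp T m \<in> Hom T (susp_obj T (src T m)) (susp_obj T (tgt T m))"
        and p: "\<phi> \<in> Hom T Y (susp_obj T (src T m))"
      show "susp T m \<cdot> \<phi> \<cdot> add_arr T f g = zero_arr T X (susp_obj T (tgt T m))"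
        using perp[of f m \<phi>] perp[of g m \<phi>] f g h HomD[OF p] HomD[OF fH] HomD[OF gH]
          comp_add_right[OF fH gH comp_Hom[OF p m]] add_zero HomD(5)[OF m] by simp
    qed
  qed
  fix f h assume f: "f \<in> ?P" and h: "h \<in> arr_in T A"
  have fA: "f \<in> arr_in T A" using sub f by blast
  note fH = arr_inD[OF fA] and hH = arr_inD[OF h]
  show "h \<cdot> f \<in> ?P" if e: "src T h = tgt T f"
  proof (rule I)
    have hH': "h \<in> Hom T (tgt T f) (tgt T h)" using hH e by simp
    show "h \<cdot> f \<in> Hom T (src T f) (tgt T h)" using comp_Hom fH hH' .
    show "src T f \<in> A" "tgt T h \<in> A" using fA h by (auto simp: arr_in_def)
    fix m \<phi> assume mp: "m \<in> M" "\<phi> \<in> phantoms E"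
      and m: "susp T m \<in> Hom T (susp_obj T (src T m)) (susp_obj T (tgt T m))"
      and p: "\<phi> \<in> Hom T (tgt T h) (susp_obj T (src T m))"
    have q: "\<phi> \<cdot> h \<in> phantoms E" using phantom_comp mp(2) h HomD(2)[OF p] by simp
    show "susp T m \<cdot> \<phi> \<cdot> (h \<cdot> f) = zero_arr T (src T f) (susp_obj T (tgt T m))"
      using comp_assoc[OF fH hH' comp_Hom[OF p m]] comp_assoc[OF hH' p m] perp[OF f mp(1) q] HomD(2,3)[OF comp_Hom[OF hH' p]]
      by simp
  qed
  show "f \<cdot> h \<in> ?P" if e: "tgt T h = src T f"
  proof (rule I)
    have hH': "h \<in> Hom T (src T h) (src T f)" using hH e by simp
    show "f \<cdot> h \<in> Hom T (src T h) (tgt T f)" using comp_Hom hH' fH .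
    show "src T h \<in> A" "tgt T f \<in> A" using fA h by (auto simp: arr_in_def)
    fix m \<phi> assume mp: "m \<in> M" "\<phi> \<in> phantoms E"
      and m: "susp T m \<in> Hom T (susp_obj T (src T m)) (susp_obj T (tgt T m))"
      and p: "\<phi> \<in> Hom T (tgt T f) (susp_obj T (src T m))"
    show "susp T m \<cdot> \<phi> \<cdot> (f \<cdot> h) = zero_arr T (src T h) (susp_obj T (tgt T m))"
      using comp_assoc[OF hH' fH comp_Hom[OF p m]] perp[OF f mp] HomD(2,3)[OF p] zero_comp[OF hH'] HomD(5)[OF m] by simp
  qed
qed

section \<open>Factoring phantoms with injective and projective morphisms\<close>

lemma ideal_comp:
  assumes "ideal_in T A M" "f \<in> M"
  shows "g \<in> arr_in T A \<Longrightarrow> src T g = tgt T f \<Longrightarrow> g \<cdot> f \<in> M"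
    "g \<in> arr_in T A \<Longrightarrow> tgt T g = src T f \<Longrightarrow> f \<cdot> g \<in> M"
  using assms by (auto simp: ideal_in_def)

text \<open>Injectivity factors the inflation of \<alpha> through the inflation of the n-angle
  \<delta> ending with \<psi>. With the identity on the common first object this starts a morphism
  from \<delta> to \<alpha>, whose wrap-around square is the claimed factorization.\<close>

lemma phantom_through_injective:
  assumes a: "\<alpha> \<in> E" and e: "E_injective T A E (\<alpha> ! 0)"
    and p: "\<psi> \<in> phantoms E" "tgt T \<psi> = susp_obj T (src T (\<alpha> ! 0))"
  obtains g where "g \<in> Hom T (src T \<psi>) (src T (\<alpha> ! (n - 1)))" "g \<in> arr_in T A" "\<psi> = \<alpha> ! (n - 1) \<cdot> g"
proof -
  let ?X = "src T (\<alpha> ! 0)"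
  note aa = E_D(1)[OF a]
  have X: "?X \<in> obj T" using angleD(3)[OF aa, of 0] n_ge_3 by simp
  obtain \<delta> where d: "\<delta> \<in> E" "\<psi> = \<delta> ! (n - 1)" "\<psi> \<in> Hom T (src T \<psi>) (susp_obj T (src T (\<delta> ! 0)))"
    using phantomE[OF p(1)] by blast
  note dd = E_D(1)[OF d(1)]
  have dX: "src T (\<delta> ! 0) = ?X"
    using susp_obj_inj[of "src T (\<delta> ! 0)" ?X] HomD(3)[OF d(3)] p(2) X angleD(3)[OF dd, of 0] n_ge_3 by simp
  have d0: "\<delta> ! 0 \<in> Hom T ?X (src T (\<delta> ! 1))" and a0: "\<alpha> ! 0 \<in> Hom T ?X (src T (\<alpha> ! 1))"
    using angleD(4)[OF dd, of 0] angleD(4)[OF aa, of 0] dX n_ge_3 by auto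
  have "\<delta> ! 0 \<in> inflations E" unfolding inflations_def using d(1) angleD(6)[OF dd] by (metis imageI)
  then obtain h where h: "h \<in> Hom T (src T (\<delta> ! 1)) (src T (\<alpha> ! 1))" "\<alpha> ! 0 = h \<cdot> \<delta> ! 0"
    using e dX HomD(3)[OF d0] HomD(3)[OF a0] by (auto simp: E_injective_def)
  have "h \<cdot> \<delta> ! 0 = \<alpha> ! 0 \<cdot> idn T ?X" using h(2)[symmetric] idn_right[OF a0] by simp
  then obtain \<phi> where \<phi>: "seq_morphism T n \<delta> \<alpha> \<phi>" "\<phi> ! 0 = idn T ?X"
    using F3[OF dd aa, of "idn T ?X" h] idn_Hom[OF X] dX h(1) by auto
  have g: "\<phi> ! (n - 1) \<in> Hom T (src T \<psi>) (src T (\<alpha> ! (n - 1)))"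
    using morphismD(4)[OF \<phi>(1), of "n - 1"] d(2) n_ge_3 by simp
  have "\<psi> = \<alpha> ! (n - 1) \<cdot> \<phi> ! (n - 1)"
    using morphismD(6)[OF \<phi>(1)] \<phi>(2) susp_idn[OF X] d(2) idn_left[OF d(3)] dX by simp
  moreover have "\<phi> ! (n - 1) \<in> arr_in T A"
    using arr_inI[OF g] E_D(2)[OF d(1), of "n - 1"] E_D(2)[OF a, of "n - 1"] d(2) n_ge_3 by simp
  ultimately show ?thesis using that g by blast
qed

text \<open>Dually, projectivity lifts the deflation of \<alpha> along that of \<delta>. The
  prescribed square sits at index \<open>n - 2\<close>, hence \<open>F3_at\<close>; the first
  component of the resulting morphism is \<open>g\<close>, read off from the wrap-around
  square.\<close>

lemma phantom_through_projective:
  assumes a: "\<alpha> \<in> E" and e: "E_projective T n A E (\<alpha> ! (n - 2))"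
    and p: "\<psi> \<in> phantoms E" "src T \<psi> = src T (\<alpha> ! (n - 1))" "tgt T \<psi> = susp_obj T M" and M: "M \<in> obj T"
  obtains g where "g \<in> Hom T (src T (\<alpha> ! 0)) M" "g \<in> arr_in T A" "\<psi> = susp T g \<cdot> \<alpha> ! (n - 1)"
proof -
  let ?X = "src T (\<alpha> ! (n - 1))"
  note aa = E_D(1)[OF a]
  have X: "?X \<in> obj T" using angleD(3)[OF aa, of "n - 1"] n_ge_3 by simp
  have n2: "Suc (n - 2) = n - 1" "n - 2 < n" using n_ge_3 by auto
  obtain \<delta> where d: "\<delta> \<in> E" "\<psi> = \<delta> ! (n - 1)" "\<psi> \<in> Hom T (src T \<psi>) (susp_obj T (src T (\<delta> ! 0)))"
    using phantomE[OF p(1)] by blast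
  note dd = E_D(1)[OF d(1)]
  have dM: "src T (\<delta> ! 0) = M"
    using susp_obj_inj[of "src T (\<delta> ! 0)" M] HomD(3)[OF d(3)] p(3) M angleD(3)[OF dd, of 0] n_ge_3 by simp
  have d2: "\<delta> ! (n - 2) \<in> Hom T (src T (\<delta> ! (n - 2))) ?X" and a2: "\<alpha> ! (n - 2) \<in> Hom T (src T (\<alpha> ! (n - 2))) ?X"
    using angleD(4)[OF dd, of "n - 2"] angleD(4)[OF aa, of "n - 2"] p(2) d(2) n2 n_ge_3 by auto
  have "\<delta> ! (n - 2) \<in> deflations n E" unfolding deflations_def using d(1) by blast
  then obtain h where h: "h \<in> Hom T (src T (\<alpha> ! (n - 2))) (src T (\<delta> ! (n - 2)))" "\<alpha> ! (n - 2) = \<delta> ! (n - 2) \<cdot> h"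
    using e HomD(3)[OF d2] HomD(3)[OF a2] by (auto simp: E_projective_def)
  have i: "idn T ?X \<in> Hom T (src T (\<alpha> ! (n - 1))) (src T (\<delta> ! (n - 1)))" using idn_Hom[OF X] p(2) d(2) by simp
  have "idn T ?X \<cdot> \<alpha> ! (n - 2) = \<delta> ! (n - 2) \<cdot> h" using h(2) idn_left[OF a2] by simp
  then obtain \<phi> where \<phi>: "seq_morphism T n \<alpha> \<delta> \<phi>" "\<phi> ! (n - 1) = idn T ?X"
    using F3_at[OF aa dd, of "n - 2" h "idn T ?X"] h(1) i n2 n_ge_3 by auto
  have g: "\<phi> ! 0 \<in> Hom T (src T (\<alpha> ! 0)) M"
    using morphismD(4)[OF \<phi>(1), of 0] dM n_ge_3 by simp
  have "\<psi> = susp T (\<phi> ! 0) \<cdot> \<alpha> ! (n - 1)"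
    using morphismD(6)[OF \<phi>(1)] \<phi>(2) d(2) idn_right[OF d(3)] p(2) by simp
  moreover have "\<phi> ! 0 \<in> arr_in T A"
    using arr_inI[OF g] E_D(2)[OF d(1), of 0] E_D(2)[OF a, of 0] dM n_ge_3 by simp
  ultimately show ?thesis using that g by blast
qed

section \<open>The two halves of Salce's lemma\<close>

lemma special_preenvelopeI:
  assumes "j \<in> M" "src T j = X" "\<alpha> \<in> angles T" "hd \<alpha> = j" "i \<in> left_perp T A E M" "\<phi> \<in> phantoms E"
    "src T i = src T (last \<alpha>)" "src T \<phi> = tgt T i" "tgt T \<phi> = susp_obj T X" "last \<alpha> = \<phi> \<cdot> i"
  shows "special_preenvelope T A E M X j"
  unfolding special_preenvelope_def
  by (intro conjI, rule assms(1), rule assms(2), rule bexI[OF _ assms(3)], intro conjI, rule assms(4),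
      rule bexI[OF _ assms(5)], rule bexI[OF _ assms(6)], intro conjI assms(7-10))

lemma special_precoverI:
  assumes "i \<in> M" "tgt T i = X" "\<alpha> \<in> angles T" "\<alpha> ! (n - 2) = i" "j \<in> right_perp T A E M" "\<phi> \<in> phantoms E"
    "src T \<phi> = X" "tgt T \<phi> = susp_obj T (src T j)" "last \<alpha> = susp T j \<cdot> \<phi>"
  shows "special_precover T n A E M X i"
  unfolding special_precover_def
  by (intro conjI, rule assms(1), rule assms(2), rule bexI[OF _ assms(3)], intro conjI, rule assms(4),
      rule bexI[OF _ assms(5)], rule bexI[OF _ assms(6)], intro conjI assms(7-9))

theorem salce_preenveloping:
  assumes inj: "enough_injective_morphisms T A E" and I: "precovering_ideal T A I"
  shows "special_preenveloping_ideal T A E (right_perp T A E I)"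
  unfolding special_preenveloping_ideal_def
proof (intro conjI ballI)
  have Ii: "ideal_in T A I" and IA: "I \<subseteq> arr_in T A" using I by (auto simp: precovering_ideal_def ideal_in_def)
  then show "ideal_in T A (right_perp T A E I)" using right_perp_ideal by blast
  fix X assume XA: "X \<in> A"
  then obtain \<alpha> where a: "\<alpha> \<in> E" and e: "E_injective T A E (\<alpha> ! 0)" and X: "src T (\<alpha> ! 0) = X"
    using inj angleD(6)[OF E_D(1)] by (fastforce simp: enough_injective_morphisms_def inflations_def)
  note aa = E_D(1)[OF a]
  let ?N = "src T (\<alpha> ! (n - 1))" and ?\<phi> = "\<alpha> ! (n - 1)"
  have "?N \<in> A" using E_D(2)[OF a] n_ge_3 by simp
  then obtain i where i: "precover T I ?N i" using I by (auto simp: precovering_ideal_def)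
  then have iI: "i \<in> I" and it: "tgt T i = ?N" by (auto simp: precover_def)
  then have iA: "i \<in> arr_in T A" using IA by blast
  have ph: "?\<phi> \<in> Hom T ?N (susp_obj T X)" using angleD(5)[OF aa] X by simp
  have iH: "i \<in> Hom T (src T i) ?N" using arr_inD[OF iA] it by simp
  obtain \<beta> where b: "\<beta> \<in> E" "src T (\<beta> ! 0) = X" "src T (\<beta> ! (n - 1)) = src T i" "\<beta> ! (n - 1) = ?\<phi> \<cdot> i"
    using ex_base_change[OF a iA it] X by metis
  note bb = E_D(1)[OF b(1)]
  let ?j = "\<beta> ! 0"
  have jH: "?j \<in> Hom T X (src T (\<beta> ! 1))" using angleD(4)[OF bb, of 0] b(2) n_ge_3 by simp
  have jA: "?j \<in> arr_in T A" using arr_inI[OF jH XA] E_D(2)[OF b(1), of 1] n_ge_3 by simp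
  have "orthogonal T E m ?j" if m: "m \<in> I" for m
    unfolding orthogonal_def
  proof (intro ballI impI, elim conjE)
    fix \<psi> assume p: "\<psi> \<in> phantoms E" "src T \<psi> = tgt T m" "tgt T \<psi> = susp_obj T (src T ?j)"
    have mH: "m \<in> Hom T (src T m) (tgt T m)" using arr_inD m IA by blast
    obtain g where g: "g \<in> Hom T (tgt T m) ?N" "g \<in> arr_in T A" "\<psi> = ?\<phi> \<cdot> g"
      using phantom_through_injective[OF a e p(1)] p(2,3) X b(2) by metis
    have gm: "g \<cdot> m \<in> Hom T (src T m) ?N" using comp_Hom mH g(1) .
    have "g \<cdot> m \<in> I" using ideal_comp(1)[OF Ii m g(2)] HomD(2)[OF g(1)] by simp
    then obtain k where k: "k \<in> Hom T (src T m) (src T i)" "g \<cdot> m = i \<cdot> k"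
      using i HomD(2,3)[OF gm] unfolding precover_def by metis
    have sj: "susp T ?j \<in> Hom T (susp_obj T X) (susp_obj T (tgt T ?j))" using susp_Hom jH HomD(3)[OF jH] by simp
    have bl: "?\<phi> \<cdot> i \<in> Hom T (src T i) (susp_obj T X)" using comp_Hom iH ph .
    have "susp T ?j \<cdot> \<psi> \<cdot> m = susp T ?j \<cdot> (\<psi> \<cdot> m)"
      using comp_assoc[OF mH comp_Hom[OF g(1) ph] sj] g(3) by simp
    also have "\<psi> \<cdot> m = ?\<phi> \<cdot> i \<cdot> k"
      using comp_assoc[OF mH g(1) ph] g(3) k(2) comp_assoc[OF k(1) iH ph] by simp
    also have "susp T ?j \<cdot> (?\<phi> \<cdot> i \<cdot> k) = (susp T ?j \<cdot> (?\<phi> \<cdot> i)) \<cdot> k"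
      using comp_assoc[OF k(1) bl sj] by simp
    \<comment> \<open>The composite \<open>?\<phi> \<cdot> i\<close> is the last morphism of
      \<beta>, so the suspension of the first morphism of \<beta> annihilates it.\<close>
    also have "\<dots> = zero_arr T (src T m) (susp_obj T (tgt T ?j))"
      using susp_comp_last_eq_zero[OF bb] b(3,4) zero_comp[OF k(1)] HomD(5)[OF sj] by simp
    finally show "susp T ?j \<cdot> \<psi> \<cdot> m = zero_arr T (src T m) (susp_obj T (tgt T ?j))" .
  qed
  then have jp: "?j \<in> right_perp T A E I" using jA by (simp add: right_perp_def)
  \<comment> \<open>Any member of \<open>I\<close> lies in this double orthogonal by definition.
    Together with \<open>last \<beta> = ?\<phi> \<cdot> i\<close> this is the specialness
    condition.\<close>
  have il: "i \<in> left_perp T A E (right_perp T A E I)"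
    using iA iI by (auto simp: left_perp_def right_perp_def)
  have "special_preenvelope T A E (right_perp T A E I) X ?j"
  proof (rule special_preenvelopeI[OF jp b(2) bb _ il phantomI[OF a]])
    show "hd \<beta> = ?j" using angleD(6)[OF bb] .
    show "src T i = src T (last \<beta>)" using b(3) angleD(7)[OF bb] by simp
    show "src T ?\<phi> = tgt T i" using it by simp
    show "tgt T ?\<phi> = susp_obj T X" using HomD(3)[OF ph] .
    show "last \<beta> = ?\<phi> \<cdot> i" using b(4) angleD(7)[OF bb] by simp
  qed
  then show "\<exists>j. special_preenvelope T A E (right_perp T A E I) X j" by blast
qed

text \<open>Take an n-angle in \<open>E\<close> whose deflation onto \<open>X\<close> is projective,
  and push its phantom along a \<open>J\<close>-preenvelope \<open>j\<close> of its first object.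
  The deflation of the resulting n-angle \<beta> is the special precover.\<close>

theorem salce_precovering:
  assumes proj: "enough_projective_morphisms T n A E" and J: "preenveloping_ideal T A J"
  shows "special_precovering_ideal T n A E (left_perp T A E J)"
  unfolding special_precovering_ideal_def
proof (intro conjI ballI)
  have Ji: "ideal_in T A J" and JA: "J \<subseteq> arr_in T A" using J by (auto simp: preenveloping_ideal_def ideal_in_def)
  then show "ideal_in T A (left_perp T A E J)" using left_perp_ideal by blast
  fix X assume XA: "X \<in> A"
  have n2: "Suc (n - 2) = n - 1" "n - 2 < n" using n_ge_3 by auto
  from XA obtain \<alpha> where a: "\<alpha> \<in> E" and e: "E_projective T n A E (\<alpha> ! (n - 2))" and "tgt T (\<alpha> ! (n - 2)) = X"
    using proj by (fastforce simp: enough_projective_morphisms_def deflations_def)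
  note aa = E_D(1)[OF a]
  have X: "src T (\<alpha> ! (n - 1)) = X"
    using angleD(4)[OF aa, of "n - 2"] n2 n_ge_3 \<open>tgt T (\<alpha> ! (n - 2)) = X\<close> by (auto simp: Hom_def)
  let ?N = "src T (\<alpha> ! 0)" and ?\<phi> = "\<alpha> ! (n - 1)"
  have "?N \<in> A" using E_D(2)[OF a] n_ge_3 by simp
  then obtain j where j: "preenvelope T J ?N j" using J by (auto simp: preenveloping_ideal_def)
  then have jJ: "j \<in> J" and js: "src T j = ?N" by (auto simp: preenvelope_def)
  then have jA: "j \<in> arr_in T A" using JA by blast
  have ph: "?\<phi> \<in> Hom T X (susp_obj T ?N)" using angleD(5)[OF aa] X by simp
  have jH: "j \<in> Hom T ?N (tgt T j)" using arr_inD[OF jA] js by simp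
  obtain \<beta> where b: "\<beta> \<in> E" "src T (\<beta> ! 0) = tgt T j" "src T (\<beta> ! (n - 1)) = X" "\<beta> ! (n - 1) = susp T j \<cdot> ?\<phi>"
    using ex_cobase_change[OF a jA js] X by metis
  note bb = E_D(1)[OF b(1)]
  let ?i = "\<beta> ! (n - 2)"
  have iH: "?i \<in> Hom T (src T ?i) X" using angleD(4)[OF bb, of "n - 2"] b(3) n2 n_ge_3 by simp
  have iA: "?i \<in> arr_in T A" using arr_inI[OF iH _ XA] E_D(2)[OF b(1) n2(2)] by simp
  note sj = susp_Hom[OF jH]
  have bl: "susp T j \<cdot> ?\<phi> \<in> Hom T X (susp_obj T (tgt T j))" using comp_Hom ph sj .
  have "orthogonal T E ?i m" if m: "m \<in> J" for m
    unfolding orthogonal_def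
  proof (intro ballI impI, elim conjE)
    fix \<psi> assume p: "\<psi> \<in> phantoms E" "src T \<psi> = tgt T ?i" "tgt T \<psi> = susp_obj T (src T m)"
    have mH: "m \<in> Hom T (src T m) (tgt T m)" using arr_inD m JA by blast
    obtain g where g: "g \<in> Hom T ?N (src T m)" "g \<in> arr_in T A" "\<psi> = susp T g \<cdot> ?\<phi>"
      using phantom_through_projective[OF a e p(1) _ p(3) HomD(4)[OF mH]] p(2) X HomD(3)[OF iH] by metis
    have mg: "m \<cdot> g \<in> Hom T ?N (tgt T m)" using comp_Hom g(1) mH .
    have "m \<cdot> g \<in> J" using ideal_comp(2)[OF Ji m g(2)] HomD(3)[OF g(1)] by simp
    \<comment> \<open>The ideal property puts \<open>m \<cdot> g\<close> into \<open>J\<close>; the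
      preenvelope then lets \<open>susp T m \<cdot> \<psi>\<close> be rewritten as a composite that
      ends with the last morphism of \<beta>.\<close>
    then obtain k where k: "k \<in> Hom T (tgt T j) (tgt T m)" "m \<cdot> g = k \<cdot> j"
      using j HomD(2,3)[OF mg] unfolding preenvelope_def by metis
    note sk = susp_Hom[OF k(1)]
    have "susp T m \<cdot> \<psi> = susp T (m \<cdot> g) \<cdot> ?\<phi>"
      using g(3) comp_assoc[OF ph susp_Hom[OF g(1)] susp_Hom[OF mH]] susp_comp[OF g(1) mH] by simp
    also have "\<dots> = susp T k \<cdot> (susp T j \<cdot> ?\<phi>)"
      using k(2) susp_comp[OF jH k(1)] comp_assoc[OF ph sj sk] by simp
    finally have "susp T m \<cdot> \<psi> \<cdot> ?i = susp T k \<cdot> (susp T j \<cdot> ?\<phi> \<cdot> ?i)"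
      using comp_assoc[OF iH bl sk] by simp
    \<comment> \<open>These are the last two morphisms of \<beta>, at indices \<open>n - 2\<close>
      and \<open>n - 1\<close>, so no sign occurs.\<close>
    also have "susp T j \<cdot> ?\<phi> \<cdot> ?i = zero_arr T (src T ?i) (susp_obj T (tgt T j))"
      using comp_eq_zero[OF bb, of "n - 2"] n2 n_ge_3 b(4) HomD(3)[OF bl] by simp
    also have "susp T k \<cdot> \<dots> = zero_arr T (src T ?i) (susp_obj T (tgt T m))"
      using comp_zero[OF sk] HomD(4)[OF iH] by simp
    finally show "susp T m \<cdot> \<psi> \<cdot> ?i = zero_arr T (src T ?i) (susp_obj T (tgt T m))" .
  qed
  then have ip: "?i \<in> left_perp T A E J" using iA by (simp add: left_perp_def)
  \<comment> \<open>Again formal: \<open>J\<close> is contained in its double orthogonal, so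
    \<open>j\<close> witnesses specialness.\<close>
  have jr: "j \<in> right_perp T A E (left_perp T A E J)"
    using jA jJ by (auto simp: left_perp_def right_perp_def)
  have "special_precover T n A E (left_perp T A E J) X ?i"
  proof (rule special_precoverI[OF ip HomD(3)[OF iH] bb refl jr phantomI[OF a] X])
    show "tgt T ?\<phi> = susp_obj T (src T j)" using HomD(3)[OF ph] js by simp
    show "last \<beta> = susp T j \<cdot> ?\<phi>" using b(4) angleD(7)[OF bb] by simp
  qed
  then show "\<exists>i. special_precover T n A E (left_perp T A E J) X i" by blast
qed

end

theorem theorem3p16:
  fixes T :: "('o, 'm) angulated_category"
    and n :: nat
    and A :: "'o set"
    and E :: "'m list set"
    and I J :: "'m set"
  assumes "n_angulated_category T n"
    and "ext_closed_subcategory T A"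
    and "almost_n_exact_structure T n A E"
    and "ideal_in T A I"
    and "ideal_in T A J"
  shows "(enough_injective_morphisms T A E \<and> precovering_ideal T A I \<longrightarrow>
            special_preenveloping_ideal T A E (right_perp T A E I)) \<and>
         (enough_projective_morphisms T n A E \<and> preenveloping_ideal T A J \<longrightarrow>
            special_precovering_ideal T n A E (left_perp T A E J))"
proof -
  interpret almost_n_exact_category T n A E
    using assms(1-3)
    by (simp add: almost_n_exact_category_def almost_n_exact_category_axioms_def ext_closed_subcategory_def)
  show ?thesis using salce_preenveloping salce_precovering by blast
qed

end
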